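(* Let $\mathbb{K}$ be an algebraically closed field of characteristic zero, $\zeta\in\mathbb{K}$ a primitive eighth root of unity and $\mathbbm{i}=\zeta^2$. In $\mathbb{P}^3$ let $e_1=[1:0:0:0]$, $e_2=[0:1:0:0]$, $e_3=[0:0:1:0]$, $e_4=[0:0:0:1]$, and for $0\le j,k\le3$ (subscripts read modulo four) let $$p_{j,k}=[1:\mathbbm{i}^j:\mathbbm{i}^k:\mathbbm{i}^{-j-k}],\qquad q_{j,k}=[1:\mathbbm{i}^j:\zeta\mathbbm{i}^k:\zeta^3\mathbbm{i}^{-j-k}].$$ (1) Let $S$ be the $\mathbb{K}$-algebra with generators $x_1,x_2,x_3,x_4$ and relations $x_1x_2-x_3^2$, $x_2x_1-x_4^2$, $x_1x_3-x_2x_4$, $x_2x_3-x_3x_1$, $x_1x_4-x_4x_2$, $x_3x_2-x_4x_1$. The point scheme of $S$ is reduced and consists of twenty distinct closed points: the $e_i$, $1\le i\le4$, and the $p_{j,k}$, $0\le j,k\le3$. The automorphism $\tau:\mathcal{P}(S)\to\mathcal{P}(S)$ fixes $e_1,e_2$, interchanges $e_3$ and $e_4$, and satisfies $\tau(p_{j,k})=p_{2k-j,k-j}$; explicitly $\tau[1:b:c:b^{-1}c^{-1}]=[1:b^3c^2:b^3c:b^2c]$. Hence $\tau$ fixes $[1:1:1:1]$ and $[1:1:-1:-1]$, and interchanges $[1:-1:1:-1]$ and $[1:-1:-1:1]$; the remaining twelve points $p_{j,k}$ partition into three orbits of size four. (2) Let $T$ be the $\mathbb{K}$-algebra with generators $x_1,x_2,x_3,x_4$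 and relations $x_1x_2-x_3^2$, $x_2x_1+x_4^2$, $x_1x_3-x_2x_4$, $x_2x_3-x_3x_1$, $x_1x_4+x_4x_2$, $x_3x_2-x_4x_1$. The point scheme of $T$ is reduced and consists of twenty distinct closed points: the $e_i$, $1\le i\le4$, and the $q_{j,k}$, $0\le j,k\le3$. The automorphism $\tau:\mathcal{P}(T)\to\mathcal{P}(T)$ fixes $e_1,e_2$, interchanges $e_3$ and $e_4$, and satisfies $\tau(q_{j,k})=q_{2k+1-j,k-j}$; explicitly $\tau[1:b:c:-b^{-1}c^{-1}]=[1:b^3c^2:b^3c:b^2c]$. The points $q_{j,k}$ partition into four orbits of size four.
   Context: Here $\mathbbm{i}$ is just the symbol for the primitive fourth root of unity $\zeta^2$. Let $A$ be a quadratic algebra with generators $x_1,\dots,x_4$ spanning $V=A_1$ and six quadratic relations. Identify $\mathbb{P}(V^* )$ with $\mathbb{P}^3$ via the basis dual to $x_1,\dots,x_4$. Write the relations as $M\mathbf{x}=\mathbf{0}$, where $M$ is a $6\times4$ matrix with entries in $V$ and $\mathbf{x}=(x_1,x_2,x_3,x_4)^T$. The point scheme $\mathcal{P}(A)$ is the closed subscheme of $\mathbb{P}^3$ defined by the fifteen $4\times4$ minors of $M$, viewed as polynomials in $\mathbb{K}[x_1,\dots,x_4]$. For the algebras in question, the scheme $\Gamma\subset\mathbb{P}^3\times\mathbb{P}^3$ of zeros of the multilinearized relations is the graph of an automorphism $\tau$ of $\mathcal{P}(A)$: for a closed point $p$, $M(p)$ has rank three and $\tau(p)$ is the point given by the kernel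 of $M(p)$. *)

theory Defs
  imports
    "HOL-Analysis.Determinants"
    "HOL-Computational_Algebra.Polynomial"
    "HOL-Library.Poly_Mapping"
    "HOL-Library.Disjoint_Sets"
    "HOL-Combinatorics.Orbits"
begin

text \<open>
  Indices \<open>1, 2, 3, 4\<close> live in the numeral type \<^typ>\<open>4\<close>, where \<open>4 = 0\<close>; likewise
  the six relations are indexed by \<^typ>\<open>6\<close>, where \<open>6 = 0\<close>.
\<close>

section \<open>The free algebra on four generators\<close>

datatype ncmonom = Word "4 list"

instantiation ncmonom :: monoid_add
begin

definition zero_ncmonom :: ncmonom
  where "zero_ncmonom = Word []"

fun plus_ncmonom :: "ncmonom \<Rightarrow> ncmonom \<Rightarrow> ncmonom"
  where "plus_ncmonom (Word u) (Word v) = Word (u @ v)"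

instance
proof
  fix a b c :: ncmonom
  show "a + b + c = a + (b + c)" by (cases a; cases b; cases c) simp
  show "0 + a = a" by (cases a) (simp add: zero_ncmonom_def)
  show "a + 0 = a" by (cases a) (simp add: zero_ncmonom_def)
qed

end

text \<open>The product of \<open>'a free_alg\<close> is the convolution product along concatenation of words.\<close>

type_synonym 'a free_alg = "ncmonom \<Rightarrow>\<^sub>0 'a"

definition gen :: "4 \<Rightarrow> 'a::field free_alg"
  where "gen i = Poly_Mapping.single (Word [i]) 1"

text \<open>
  A quadratic algebra on the generators \<open>x\<^sub>1, \<dots>, x\<^sub>4\<close> with six relations is given by its
  presentation: a vector of six homogeneous elements of degree two of the free algebra.
\<close>

type_synonym 'a presentation = "('a free_alg)^6"

section \<open>Commutative polynomials in four variables\<close>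

type_synonym 'a poly4 = "(4 \<Rightarrow>\<^sub>0 nat) \<Rightarrow>\<^sub>0 'a"

definition Var :: "4 \<Rightarrow> 'a::field poly4"
  where "Var i = Poly_Mapping.single (Poly_Mapping.single i 1) 1"

definition Const :: "'a::field \<Rightarrow> 'a poly4"
  where "Const c = Poly_Mapping.single 0 c"

definition eval4 :: "'a::field ^ 4 \<Rightarrow> 'a poly4 \<Rightarrow> 'a"
  where "eval4 v f =
    (\<Sum>m\<in>Poly_Mapping.keys f. Poly_Mapping.lookup f m * (\<Prod>i\<in>UNIV. (v $ i) ^ Poly_Mapping.lookup m i))"

definition ideal_gen :: "'r::comm_ring_1 set \<Rightarrow> 'r set"
  where "ideal_gen B = module.span (*) B"

definition radical_ideal :: "'r::comm_ring_1 set \<Rightarrow> bool"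
  where "radical_ideal I \<longleftrightarrow> (\<forall>f n. f ^ n \<in> I \<longrightarrow> f \<in> I)"

section \<open>Closed subschemes of projective three-space\<close>

text \<open>A closed point of \<open>\<P>\<^sup>3\<close> is a line through the origin of \<open>K\<^sup>4\<close>, as a set of vectors.\<close>

type_synonym 'a point = "('a ^ 4) set"

definition line :: "'a::field ^ 4 \<Rightarrow> 'a point"
  where "line v = range (\<lambda>c. c *s v)"

definition P3 :: "'a::field point set"
  where "P3 = line ` {v. v \<noteq> 0}"

definition pt :: "'a::field \<Rightarrow> 'a \<Rightarrow> 'a \<Rightarrow> 'a \<Rightarrow> 'a point"
  where "pt a b c d = line (vector [a, b, c, d])"

definition e_pt :: "4 \<Rightarrow> 'a::field point"
  where "e_pt i = line (axis i 1)"

text \<open>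
  A closed subscheme of \<open>\<P>\<^sup>3\<close> is given by a set \<open>F\<close> of homogeneous equations.
\<close>

definition closed_points :: "'a::field poly4 set \<Rightarrow> 'a point set"
  where "closed_points F = {p \<in> P3. \<forall>v\<in>p. \<forall>f\<in>F. eval4 v f = 0}"

text \<open>
  The coordinate ring of the affine chart \<open>x\<^sub>i \<noteq> 0\<close> of the subscheme, that is, the degree-zero
  part of the localization of \<open>K[x\<^sub>1,\<dots>,x\<^sub>4]/(F)\<close> at \<open>x\<^sub>i\<close>, is the dehomogenization
  \<open>K[x\<^sub>1,\<dots>,x\<^sub>4]/(F, x\<^sub>i - 1)\<close>. The scheme is reduced iff these four rings have no nonzero
  nilpotent elements.
\<close>

definition chart_ideal :: "'a::field poly4 set \<Rightarrow> 4 \<Rightarrow> 'a poly4 set"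
  where "chart_ideal F i = ideal_gen (F \<union> {Var i - 1})"

definition reduced_scheme :: "'a::field poly4 set \<Rightarrow> bool"
  where "reduced_scheme F \<longleftrightarrow> (\<forall>i. radical_ideal (chart_ideal F i))"

section \<open>The point scheme of a presented quadratic algebra\<close>

definition rel_coeff :: "'a::field presentation \<Rightarrow> 6 \<Rightarrow> 4 \<Rightarrow> 4 \<Rightarrow> 'a"
  where "rel_coeff R r i j = Poly_Mapping.lookup (R $ r) (Word [i, j])"

text \<open>
  The matrix \<open>M\<close> with \<open>M x\<close> the vector of relations: row \<open>r\<close> has entry
  \<open>\<Sum>\<^sub>i c\<^sub>i\<^sub>j x\<^sub>i\<close> in column \<open>j\<close> if relation \<open>r\<close> is \<open>\<Sum>\<^sub>i\<^sub>j c\<^sub>i\<^sub>j x\<^sub>i x\<^sub>j\<close>.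
\<close>

definition rel_matrix :: "'a::field presentation \<Rightarrow> ('a poly4)^4^6"
  where "rel_matrix R = (\<chi> r j. \<Sum>i\<in>UNIV. Const (rel_coeff R r i j) * Var i)"

definition rel_matrix_at :: "'a::field presentation \<Rightarrow> 'a ^ 4 \<Rightarrow> 'a ^ 4 ^ 6"
  where "rel_matrix_at R v = (\<chi> r j. eval4 v (rel_matrix R $ r $ j))"

text \<open>The fifteen minors correspond to the increasing choices \<open>\<sigma>\<close> of four of the six rows.\<close>

definition point_scheme :: "'a::field presentation \<Rightarrow> 'a poly4 set"
  where "point_scheme R =
    {det (\<chi> i j. rel_matrix R $ \<sigma> i $ j) | \<sigma> :: 4 \<Rightarrow> 6. strict_mono \<sigma>}"

text \<open>
  Closed points of the scheme of zeros in \<open>\<P>\<^sup>3 \<times> \<P>\<^sup>3\<close> of the multilinearized relations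
  \<open>\<Sum>\<^sub>i\<^sub>j c\<^sub>i\<^sub>j v\<^sub>i w\<^sub>j\<close>.
\<close>

definition Gamma :: "'a::field presentation \<Rightarrow> ('a point \<times> 'a point) set"
  where "Gamma R = {(p, q). p \<in> P3 \<and> q \<in> P3 \<and>
    (\<forall>v\<in>p. \<forall>w\<in>q. \<forall>r. (\<Sum>i\<in>UNIV. \<Sum>j\<in>UNIV. rel_coeff R r i j * v $ i * w $ j) = 0)}"

text \<open>The kernel of \<open>M(p)\<close>; it is a line, hence itself a point, whenever \<open>M(p)\<close> has rank three.\<close>

definition tau :: "'a::field presentation \<Rightarrow> 'a point \<Rightarrow> 'a point"
  where "tau R p = {w. \<forall>v\<in>p. rel_matrix_at R v *v w = 0}"

text \<open>
  A reduced finite scheme over an algebraically closed field is a disjoint union of copies of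
  the spectrum of that field, so its automorphisms over the field are the permutations of its
  closed points.
\<close>

definition tau_automorphism :: "'a::field presentation \<Rightarrow> bool"
  where "tau_automorphism R \<longleftrightarrow>
    (\<forall>p\<in>closed_points (point_scheme R). \<forall>v\<in>p. v \<noteq> 0 \<longrightarrow> rank (rel_matrix_at R v) = 3) \<and>
    Gamma R = {(p, tau R p) | p. p \<in> closed_points (point_scheme R)} \<and>
    bij_betw (tau R) (closed_points (point_scheme R)) (closed_points (point_scheme R))"

section \<open>The algebras and the points\<close>

definition rels_S :: "'a::field presentation"
  where "rels_S = vector
    [gen 1 * gen 2 - gen 3 ^ 2,
     gen 2 * gen 1 - gen 4 ^ 2,
     gen 1 * gen 3 - gen 2 * gen 4,
     gen 2 * gen 3 - gen 3 * gen 1,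
     gen 1 * gen 4 - gen 4 * gen 2,
     gen 3 * gen 2 - gen 4 * gen 1]"

definition rels_T :: "'a::field presentation"
  where "rels_T = vector
    [gen 1 * gen 2 - gen 3 ^ 2,
     gen 2 * gen 1 + gen 4 ^ 2,
     gen 1 * gen 3 - gen 2 * gen 4,
     gen 2 * gen 3 - gen 3 * gen 1,
     gen 1 * gen 4 + gen 4 * gen 2,
     gen 3 * gen 2 - gen 4 * gen 1]"

definition primitive_root_of_unity :: "nat \<Rightarrow> 'a::field \<Rightarrow> bool"
  where "primitive_root_of_unity n z \<longleftrightarrow> z ^ n = 1 \<and> (\<forall>k. 0 < k \<and> k < n \<longrightarrow> z ^ k \<noteq> 1)"

text \<open>With \<open>\<zeta>\<close> a primitive eighth root of unity, \<open>\<zeta>\<^sup>2\<close> is the chosen primitive fourth root.\<close>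

definition p_pt :: "'a::field \<Rightarrow> int \<Rightarrow> int \<Rightarrow> 'a point"
  where "p_pt \<zeta> j k = pt 1 ((\<zeta>^2) powi j) ((\<zeta>^2) powi k) ((\<zeta>^2) powi (- j - k))"

definition q_pt :: "'a::field \<Rightarrow> int \<Rightarrow> int \<Rightarrow> 'a point"
  where "q_pt \<zeta> j k =
    pt 1 ((\<zeta>^2) powi j) (\<zeta> * (\<zeta>^2) powi k) (\<zeta>^3 * (\<zeta>^2) powi (- j - k))"

text \<open>\<open>A\<close> is the disjoint union of \<open>n\<close> orbits of \<open>f\<close>, each of them of size \<open>m\<close>.\<close>

definition partitions_into_orbits :: "('b \<Rightarrow> 'b) \<Rightarrow> 'b set \<Rightarrow> nat \<Rightarrow> nat \<Rightarrow> bool"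
  where "partitions_into_orbits f A n m \<longleftrightarrow>
    partition_on A (orbit f ` A) \<and> card (orbit f ` A) = n \<and> (\<forall>B\<in>orbit f ` A. card B = m)"

end

theory Submission
  imports Defs
begin

text \<open>
  The two algebras are the cases \<open>s = 1\<close> and \<open>s = -1\<close> of one family of relations. Writing
  \<open>a, b, c, d\<close> for the coordinates, all the minors of \<open>M\<close> are binomials, and suitable combinations
  of them are \<open>x y\<^sup>5 - \<epsilon> x\<^sup>5 y\<close> with \<open>\<epsilon> \<in> {1, s}\<close> for every pair of coordinates \<open>x, y\<close>. On the
  chart \<open>x = 1\<close> each other coordinate is thus a root of the squarefree split polynomial
  \<open>y\<^sup>5 - \<epsilon> y\<close>, so the chart ideal is radical by Seidenberg's criterion. The closed points other
  than the \<open>e\<^sub>i\<close> are the \<open>[1 : b : c : b\<^sup>3 c\<^sup>3]\<close> with \<open>b\<^sup>4 = 1\<close> and \<open>c\<^sup>4 = s\<close>. Solving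
  \<open>M w = 0\<close> gives \<open>\<tau>\<close> in these parameters as \<open>(b, c) \<mapsto> (b\<^sup>3 c\<^sup>2, b\<^sup>3 c)\<close>, whose square is
  inversion \<open>(b, c) \<mapsto> (b\<^sup>-\<^sup>1, c\<^sup>-\<^sup>1)\<close>. Hence \<open>\<tau>\<close> has order four, and an orbit has size four
  unless \<open>b\<^sup>2 = c\<^sup>2 = 1\<close>, which requires \<open>s = 1\<close>.
\<close>

section \<open>Polynomials in four variables\<close>

text \<open>Polynomials and their exponent vectors are both finitely supported maps, so one rule
  serves for both. Giving a fresh key a value is the same as adding a \<open>single\<close>.\<close>

lemma poly_mapping_induct [case_names single add]:
  assumes single: "\<And>k c. P (Poly_Mapping.single k c)"
    and add: "\<And>f g. P f \<Longrightarrow> P g \<Longrightarrow> P (f + g)"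
  shows "P f"
proof (induction f rule: update_induct)
  case const
  then show ?case using single[of undefined 0] by simp
next
  case (update f a b)
  have "Poly_Mapping.update a b f = f + Poly_Mapping.single a b"
    using update(1)
    by (intro poly_mapping_eqI) (auto simp: lookup_update lookup_add lookup_single in_keys_iff)
  then show ?case using update add single by simp
qed

lemma Const_add: "Const (a + b) = Const a + Const b"
  by (simp add: Const_def single_add)

lemma Const_mult: "Const (a * b) = Const a * Const b"
  by (simp add: Const_def mult_single)

lemma Const_uminus: "Const (- a) = - Const a"
  by (simp add: Const_def single_uminus)

lemma Const_diff: "Const (a - b) = Const a - Const b"
  by (simp add: Const_def single_diff)

lemma Const_0 [simp]: "Const 0 = 0"
  and Const_1 [simp]: "Const 1 = 1"
  by (simp_all add: Const_def)

lemma Const_power: "Const (a ^ n) = Const a ^ n"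
  by (induction n) (simp_all add: Const_mult)

lemma Var_power: "Var i ^ n = Poly_Mapping.single (Poly_Mapping.single i n) 1"
  by (induction n) (simp_all add: Var_def mult_single single_add[symmetric])

text \<open>Constants and variables generate the polynomial ring. The inner induction runs over the
  exponent vector and splits a monomial into powers of variables.\<close>

lemma poly4_induct [case_names Const Var add mult]:
  assumes Const: "\<And>c. P (Const c)" and Var: "\<And>i. P (Var i)"
    and add: "\<And>f g. P f \<Longrightarrow> P g \<Longrightarrow> P (f + g)"
    and mult: "\<And>f g. P f \<Longrightarrow> P g \<Longrightarrow> P (f * g)"
  shows "P (f :: 'a::field poly4)"
proof (induction f rule: poly_mapping_induct)
  case (single m c)
  show ?case
  proof (induction m arbitrary: c rule: poly_mapping_induct)
    case (single i n)
    have "P (Var i ^ n)"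
      using Const[of 1] by (induction n) (auto intro: Var mult)
    moreover have "Poly_Mapping.single (Poly_Mapping.single i n) c = Const c * Var i ^ n"
      by (simp add: Var_power Const_def mult_single)
    ultimately show ?case by (simp add: Const mult)
  next
    case (add m m')
    have "Poly_Mapping.single (m + m') c = Poly_Mapping.single m c * Poly_Mapping.single m' 1"
      by (simp add: mult_single)
    then show ?case by (simp add: add mult)
  qed
qed (fact add)

section \<open>Evaluation at a vector as a ring homomorphism\<close>

lemma eval4_eq_sum:
  assumes "finite A" "Poly_Mapping.keys f \<subseteq> A"
  shows "eval4 v f = (\<Sum>m\<in>A. Poly_Mapping.lookup f m * (\<Prod>i\<in>UNIV. (v $ i) ^ Poly_Mapping.lookup m i))"
  unfolding eval4_def using assms by (intro sum.mono_neutral_left) (auto simp: in_keys_iff)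

lemma eval4_add: "eval4 v (f + g) = eval4 v f + eval4 v g"
proof -
  let ?A = "Poly_Mapping.keys f \<union> Poly_Mapping.keys g"
  have "Poly_Mapping.keys (f + g) \<subseteq> ?A" by (rule keys_add)
  then show ?thesis
    by (simp add: eval4_eq_sum[of ?A] lookup_add distrib_right sum.distrib)
qed

lemma eval4_single:
  "eval4 v (Poly_Mapping.single m c) = c * (\<Prod>i\<in>UNIV. (v $ i) ^ Poly_Mapping.lookup m i)"
  by (simp add: eval4_eq_sum[of "{m}"])

text \<open>Both sides are additive in each factor, so products of two monomials are enough.\<close>

lemma eval4_mult: "eval4 v (f * g) = eval4 v f * eval4 v g"
proof (induction f rule: poly_mapping_induct)
  case (single m c)
  show ?case
    by (induction g rule: poly_mapping_induct)
      (simp_all add: mult_single eval4_single lookup_add power_add prod.distrib eval4_add distrib_left)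
qed (simp add: eval4_add distrib_right)

lemma eval4_Const [simp]: "eval4 v (Const c) = c"
  by (simp add: Const_def eval4_single)

lemma eval4_Var [simp]: "eval4 v (Var i) = v $ i"
proof -
  have "(\<Prod>j\<in>UNIV. (v $ j) ^ Poly_Mapping.lookup (Poly_Mapping.single i (1::nat)) j)
    = (\<Prod>j\<in>UNIV. if j = i then v $ j else 1)"
    by (intro prod.cong) (auto simp: lookup_single)
  then show ?thesis by (simp add: Var_def eval4_single)
qed

lemma eval4_0 [simp]: "eval4 v 0 = 0"
  by (simp add: eval4_def)

lemma eval4_1 [simp]: "eval4 v 1 = 1"
  using eval4_Const[of v 1] by simp

lemma eval4_uminus: "eval4 v (- f) = - eval4 v f"
  using eval4_add[of v "- f" f] by (simp add: eq_neg_iff_add_eq_0)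

lemma eval4_diff: "eval4 v (f - g) = eval4 v f - eval4 v g"
  using eval4_add[of v f "- g"] by (simp add: eval4_uminus)

lemma eval4_power: "eval4 v (f ^ n) = eval4 v f ^ n"
  by (induction n) (simp_all add: eval4_mult)

lemma eval4_sum: "eval4 v (\<Sum>x\<in>A. f x) = (\<Sum>x\<in>A. eval4 v (f x))"
  by (induction A rule: infinite_finite_induct) (simp_all add: eval4_add)

lemma eval4_prod: "eval4 v (\<Prod>x\<in>A. f x) = (\<Prod>x\<in>A. eval4 v (f x))"
  by (induction A rule: infinite_finite_induct) (simp_all add: eval4_mult)

lemma eval4_of_int: "eval4 v (of_int k) = of_int k"
  using eval4_Const[of v "of_int k"] by (simp add: Const_def)

lemma eval4_det: "eval4 v (det A) = det (\<chi> i j. eval4 v (A $ i $ j))"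
  by (simp add: det_def eval4_sum eval4_mult eval4_prod eval4_of_int)

section \<open>Split zero-dimensional ideals\<close>

text \<open>Ideals are the submodules of the ring over itself, so facts about spans become facts
  about ideals.\<close>

lemma module_times: "module ((*) :: 'r::comm_ring_1 \<Rightarrow> 'r \<Rightarrow> 'r)"
  by unfold_locales (simp_all add: algebra_simps)

lemma ideal_gen_base: "x \<in> B \<Longrightarrow> x \<in> ideal_gen B"
  unfolding ideal_gen_def by (rule module.span_base[OF module_times])

lemma ideal_gen_add: "x \<in> ideal_gen B \<Longrightarrow> y \<in> ideal_gen B \<Longrightarrow> x + y \<in> ideal_gen B"
  unfolding ideal_gen_def by (rule module.span_add[OF module_times])

lemma ideal_gen_diff: "x \<in> ideal_gen B \<Longrightarrow> y \<in> ideal_gen B \<Longrightarrow> x - y \<in> ideal_gen B"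
  unfolding ideal_gen_def by (rule module.span_diff[OF module_times])

lemma ideal_gen_mult: "x \<in> ideal_gen B \<Longrightarrow> r * x \<in> ideal_gen B"
  unfolding ideal_gen_def by (rule module.span_scale[OF module_times])

lemma ideal_gen_zero: "0 \<in> ideal_gen B"
  unfolding ideal_gen_def by (rule module.span_zero[OF module_times])

lemma ideal_gen_mono: "B \<subseteq> C \<Longrightarrow> ideal_gen B \<subseteq> ideal_gen C"
  unfolding ideal_gen_def by (rule module.span_mono[OF module_times])

lemma ideal_gen_insert: "x \<in> ideal_gen (insert b B) \<longleftrightarrow> (\<exists>r. x - r * b \<in> ideal_gen B)"
  unfolding ideal_gen_def by (rule module.span_breakdown_eq[OF module_times])

text \<open>The remainder theorem for division by \<open>x - Const \<beta>\<close>. It supplies the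
  Bezout relation between one linear factor and the product of the others.\<close>

lemma prod_linear_factors_remainder:
  fixes x :: "'a::field poly4"
  assumes "finite A"
  shows "\<exists>w. (\<Prod>\<alpha>\<in>A. x - Const \<alpha>) = Const (\<Prod>\<alpha>\<in>A. \<beta> - \<alpha>) + w * (x - Const \<beta>)"
  using assms
proof (induction A)
  case (insert \<alpha> A)
  then obtain w where w: "(\<Prod>\<alpha>\<in>A. x - Const \<alpha>) = Const (\<Prod>\<alpha>\<in>A. \<beta> - \<alpha>) + w * (x - Const \<beta>)"
    by blast
  have "(\<Prod>\<alpha>\<in>insert \<alpha> A. x - Const \<alpha>) = Const (\<Prod>\<alpha>\<in>insert \<alpha> A. \<beta> - \<alpha>)
      + (Const (\<Prod>\<alpha>\<in>A. \<beta> - \<alpha>) + w * (x - Const \<alpha>)) * (x - Const \<beta>)"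
    using insert(1,2) by (simp add: w Const_mult Const_diff algebra_simps)
  then show ?case by blast
qed simp

text \<open>Linear factors with distinct roots are pairwise coprime, so an ideal containing their
  product is the intersection of its enlargements by the single factors. The induction splits off
  one root \<open>\<beta>\<close> and treats the product \<open>h\<close> of the other factors as
  one further generator.\<close>

lemma ideal_gen_split_linear_factors:
  fixes x f :: "'a::field poly4"
  assumes "finite A" and "(\<Prod>\<alpha>\<in>A. x - Const \<alpha>) \<in> ideal_gen B"
    and "\<And>\<alpha>. \<alpha> \<in> A \<Longrightarrow> f \<in> ideal_gen (insert (x - Const \<alpha>) B)"
  shows "f \<in> ideal_gen B"
  using assms
proof (induction A arbitrary: B)
  case empty
  \<comment> \<open>The empty product is 1, so the ideal is the whole ring.\<close>
  then show ?case using ideal_gen_mult[of 1 B f] by simp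
next
  case (insert \<beta> A)
  define h where "h = (\<Prod>\<alpha>\<in>A. x - Const \<alpha>)"
  have "f \<in> ideal_gen (insert h B)"
  proof (rule insert.IH)
    show "(\<Prod>\<alpha>\<in>A. x - Const \<alpha>) \<in> ideal_gen (insert h B)"
      by (simp add: ideal_gen_base h_def)
    show "f \<in> ideal_gen (insert (x - Const \<alpha>) (insert h B))" if "\<alpha> \<in> A" for \<alpha>
      using insert.prems(2)[of \<alpha>] that
        ideal_gen_mono[of "insert (x - Const \<alpha>) B" "insert (x - Const \<alpha>) (insert h B)"]
      by blast
  qed
  then obtain k where k: "f - k * h \<in> ideal_gen B" by (auto simp: ideal_gen_insert)
  obtain l where l: "f - l * (x - Const \<beta>) \<in> ideal_gen B"
    using insert.prems(2)[of \<beta>] by (auto simp: ideal_gen_insert)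
  have xh: "(x - Const \<beta>) * h \<in> ideal_gen B"
    using insert.prems(1) insert.hyps by (simp add: h_def)
  obtain w where w: "h = Const (\<Prod>\<alpha>\<in>A. \<beta> - \<alpha>) + w * (x - Const \<beta>)"
    unfolding h_def using prod_linear_factors_remainder[OF insert.hyps(1)] by blast
  define u where "u = (\<Prod>\<alpha>\<in>A. \<beta> - \<alpha>)"
  \<comment> \<open>Since \<open>\<beta>\<close> is not in \<open>A\<close>, the value
    \<open>u\<close> of \<open>h\<close> at \<open>\<beta>\<close> is a unit.\<close>
  have "u \<noteq> 0" using insert.hyps by (auto simp: u_def)
  \<comment> \<open>Multiply \<open>u = h - w * (x - \<beta>)\<close> by \<open>f\<close>. In
    \<open>h * f\<close> use the congruence of \<open>f\<close> modulo \<open>x - \<beta>\<close>,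
    in \<open>(x - \<beta>) * f\<close> the one modulo \<open>h\<close>; what remains are multiples
    of \<open>(x - \<beta>) * h\<close>.\<close>
  have "Const u * f = (h * (f - l * (x - Const \<beta>)) + l * ((x - Const \<beta>) * h))
      - w * ((x - Const \<beta>) * (f - k * h) + k * ((x - Const \<beta>) * h))"
  proof -
    have u: "Const u = h - w * (x - Const \<beta>)" using w by (simp add: u_def)
    show ?thesis unfolding u by (simp add: algebra_simps)
  qed
  also have "\<dots> \<in> ideal_gen B"
    by (intro ideal_gen_diff ideal_gen_add ideal_gen_mult k l xh)
  finally have "Const (inverse u) * (Const u * f) \<in> ideal_gen B"
    by (rule ideal_gen_mult)
  then show ?case
    using \<open>u \<noteq> 0\<close> by (simp add: mult.assoc[symmetric] Const_mult[symmetric])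
qed

text \<open>Modulo such an ideal every variable is congruent to a scalar, hence so is every
  polynomial.\<close>

lemma ideal_gen_residue:
  fixes f :: "'a::field poly4"
  assumes "\<And>i. \<exists>c. Var i - Const c \<in> ideal_gen B"
  shows "\<exists>c. f - Const c \<in> ideal_gen B"
proof (induction f rule: poly4_induct)
  case (Const c)
  show ?case by (rule exI[of _ c]) (simp add: ideal_gen_zero)
next
  case (Var i)
  show ?case by (rule assms)
next
  case (add f g)
  then obtain c d where "f - Const c \<in> ideal_gen B" "g - Const d \<in> ideal_gen B" by blast
  then have "(f - Const c) + (g - Const d) \<in> ideal_gen B" by (rule ideal_gen_add)
  then show ?case by (intro exI[of _ "c + d"]) (simp add: Const_add algebra_simps)
next
  case (mult f g)
  then obtain c d where "f - Const c \<in> ideal_gen B" "g - Const d \<in> ideal_gen B" by blast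
  then have "g * (f - Const c) + Const c * (g - Const d) \<in> ideal_gen B"
    by (intro ideal_gen_add ideal_gen_mult)
  then show ?case by (intro exI[of _ "c * d"]) (simp add: Const_mult algebra_simps)
qed

text \<open>If the residue \<open>c\<close> of \<open>f\<close> is zero, then \<open>f\<close>
  itself is in the ideal. Otherwise the unit \<open>c ^ n\<close> is in it, and the ideal is the
  whole ring.\<close>

lemma power_mem_ideal_gen_rational_point:
  fixes f :: "'a::field poly4"
  assumes "\<And>i. \<exists>c. Var i - Const c \<in> ideal_gen B" and "f ^ n \<in> ideal_gen B"
  shows "f \<in> ideal_gen B"
proof -
  obtain c where c: "f - Const c \<in> ideal_gen B"
    using ideal_gen_residue[OF assms(1)] by blast
  show ?thesis
  proof (cases "c = 0")
    case True
    then show ?thesis using c by simp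
  next
    case False
    have "f ^ n - Const c ^ n \<in> ideal_gen B"
      unfolding power_diff_sumr2 mult.commute[of "f - Const c"] using c by (rule ideal_gen_mult)
    with assms(2) have "f ^ n - (f ^ n - Const c ^ n) \<in> ideal_gen B"
      by (rule ideal_gen_diff)
    then have "Const (c ^ n) \<in> ideal_gen B" by (simp add: Const_power)
    then have "(f * Const (inverse (c ^ n))) * Const (c ^ n) \<in> ideal_gen B"
      by (rule ideal_gen_mult)
    then show ?thesis
      using False by (simp add: mult.assoc Const_mult[symmetric])
  qed
qed

text \<open>
  Seidenberg's criterion for split polynomials: modulo each rational point of the grid
  \<open>\<Prod>\<^sub>i A i\<close> the quotient is a field or zero, and the ideal is the intersection of its
  enlargements by the maximal ideals of these points.
\<close>

lemma radical_ideal_if_split_univariate: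
  fixes B :: "'a::field poly4 set"
  assumes fin: "\<And>i. finite (A i)"
    and prod: "\<And>i. (\<Prod>\<alpha>\<in>A i. Var i - Const \<alpha>) \<in> ideal_gen B"
  shows "radical_ideal (ideal_gen B)"
  unfolding radical_ideal_def
proof (intro allI impI)
  fix f n
  assume f: "f ^ n \<in> ideal_gen B"
  \<comment> \<open>\<open>C\<close> is any superset of \<open>B\<close>, so that the step can be
    repeated for the four variables in turn.\<close>
  have split: "f \<in> ideal_gen C"
    if "B \<subseteq> C" "\<And>\<alpha>. f \<in> ideal_gen (insert (Var i - Const \<alpha>) C)" for i C
    using ideal_gen_split_linear_factors[OF fin, of "Var i" i] that prod[of i] ideal_gen_mono[of B C]
    by blast
  have point: "f \<in> ideal_gen (insert (Var 4 - Const a4) (insert (Var 3 - Const a3)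
      (insert (Var 2 - Const a2) (insert (Var 1 - Const a1) B))))" (is "f \<in> ideal_gen ?C")
    for a1 a2 a3 a4
  proof (rule power_mem_ideal_gen_rational_point)
    show "\<exists>c. Var i - Const c \<in> ideal_gen ?C" for i
      using exhaust_4[of i] by (auto intro!: ideal_gen_base)
    show "f ^ n \<in> ideal_gen ?C"
      using f ideal_gen_mono[of B ?C] by blast
  qed
  show "f \<in> ideal_gen B"
    apply (rule split[of _ 1], simp)
    apply (rule split[of _ 2], blast)
    apply (rule split[of _ 3], blast)
    apply (rule split[of _ 4], blast)
    apply (rule point)
    done
qed

section \<open>Linear algebra and orbits\<close>

lemma sum_axis_mult: "sum (\<lambda>j. axis k 1 $ j * x $ j) UNIV = (x :: 'a::field ^ 'n) $ k"
proof -
  have "sum (\<lambda>j. axis k 1 $ j * x $ j) UNIV = sum (\<lambda>j. if j = k then x $ j else 0) UNIV"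
    by (intro sum.cong) (auto simp: axis_def)
  then show ?thesis by simp
qed

text \<open>Rank-nullity for a one-dimensional kernel. One more row brings the row rank to its
  maximum, so it falls short by at most one; it does fall short, because \<open>w\<close> is a
  nonzero kernel vector.\<close>

lemma rank_eq_if_kernel_line:
  fixes A :: "'a::field^'n^'m"
  assumes "w \<noteq> 0" and ker: "{x. A *v x = 0} = range (\<lambda>c. c *s w)"
  shows "rank A + 1 = CARD('n)"
proof -
  obtain k where k: "w $ k \<noteq> 0" using \<open>w \<noteq> 0\<close> by (auto simp: vec_eq_iff)
  \<comment> \<open>An additional row not annihilating \<open>w\<close> makes the kernel trivial, so that the rows span.\<close>
  define A' :: "'a^'n^('m option)"
    where "A' = (\<chi> r. case r of None \<Rightarrow> axis k 1 | Some r \<Rightarrow> A $ r)"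
  have "x = 0" if x: "A' *v x = 0" for x
  proof -
    have rows: "(\<Sum>j\<in>UNIV. A' $ r $ j * x $ j) = 0" for r
      using arg_cong[OF x, of "\<lambda>y. y $ r"] by (simp add: matrix_vector_mult_def)
    have "A *v x = 0"
      using rows[of "Some r" for r] by (simp add: A'_def matrix_vector_mult_def vec_eq_iff)
    then obtain c where c: "x = c *s w" using ker by auto
    have "x $ k = 0"
      using rows[of None] by (simp add: A'_def sum_axis_mult)
    then show "x = 0" using c k by simp
  qed
  then have "vec.span (rows A') = UNIV"
    using matrix_left_invertible_span_rows_gen[of A'] matrix_left_invertible_ker[of A'] by blast
  moreover have "rows A' = insert (axis k 1) (rows A)"
  proof -
    have "row None A' = axis k 1" "row (Some r) A' = row r A" for r
      by (simp_all add: row_def A'_def vec_nth_inverse)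
    moreover have "rows A' = range (\<lambda>r. row r A')" "rows A = range (\<lambda>r. row r A)"
      by (auto simp: rows_def)
    ultimately show ?thesis by (simp add: UNIV_option_conv image_image)
  qed
  ultimately have "vec.dim (insert (axis k 1) (rows A)) = CARD('n)"
    by (metis vec.dim_span vec_dim_card)
  then have "CARD('n) \<le> rank A + 1"
    by (simp add: row_rank_def_gen vec.dim_insert split: if_splits)
  moreover have "rank A \<noteq> CARD('n)"
  proof
    assume "rank A = CARD('n)"
    then have "vec.span (rows A) = UNIV"
      by (metis row_rank_def_gen vec.dim_eq_full vec.span_UNIV vec_dim_card)
    then have "\<forall>x. A *v x = 0 \<longrightarrow> x = 0"
      using matrix_left_invertible_span_rows_gen[of A] matrix_left_invertible_ker[of A] by blast
    moreover have "A *v w = 0"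
      using ker by (metis (mono_tags) mem_Collect_eq rangeI vec.scale_one)
    ultimately show False using \<open>w \<noteq> 0\<close> by blast
  qed
  moreover have "rank A \<le> CARD('n)"
    by (simp add: row_rank_def_gen dim_subset_UNIV_cart_gen)
  ultimately show ?thesis by simp
qed

text \<open>The period of each point divides four but not two, so it is four. The number of orbits
  then follows by counting \<open>A\<close>.\<close>

lemma partitions_into_orbits_of_size_4:
  assumes "finite A" "card A = n * 4"
    and f: "\<And>x. x \<in> A \<Longrightarrow> f x \<in> A"
    and f4: "\<And>x. x \<in> A \<Longrightarrow> f (f (f (f x))) = x"
    and f2: "\<And>x. x \<in> A \<Longrightarrow> f (f x) \<noteq> x"
  shows "partitions_into_orbits f A n 4"
proof -
  \<comment> \<open>\<open>orbit f x\<close> is generated from \<open>f x\<close> onwards;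
    \<open>x\<close> belongs to it only because of periodicity.\<close>
  have orbit: "orbit f x = {x, f x, f (f x), f (f (f x))}" if "x \<in> A" for x
  proof -
    have "(f ^^ Suc (Suc (Suc (Suc 0)))) x = x" using f4[OF that] by simp
    then have "orbit f x = (\<lambda>m. (f ^^ m) x) ` {..<Suc (Suc (Suc (Suc 0)))}"
      by (subst orbit_altdef_bounded[of "Suc (Suc (Suc (Suc 0)))"]) auto
    then show ?thesis by (auto simp: lessThan_Suc)
  qed
  have card4: "card (orbit f x) = 4" if x: "x \<in> A" for x
  proof -
    have "f x \<noteq> x" using f2[OF x] by auto
    moreover have "f (f x) \<noteq> f x" using f2[OF x] f4[OF x] by auto
    moreover have "f (f (f x)) \<noteq> x" using f2[OF x] f4[OF x] by auto
    moreover have "f (f (f x)) \<noteq> f x" using f2[OF f[OF x]] by auto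
    moreover have "f (f (f x)) \<noteq> f (f x)" using f2[OF x] f4[OF x] by metis
    ultimately show ?thesis using f2[OF x] by (simp add: orbit[OF x])
  qed
  have same: "orbit f y = orbit f x" if "x \<in> A" "y \<in> orbit f x" for x y
  proof -
    have "y \<in> A" using that orbit f by auto
    have "y \<in> {x, f x, f (f x), f (f (f x))}" using that orbit by simp
    then show ?thesis using f4[OF that(1)] by (auto simp: orbit[OF that(1)] orbit[OF \<open>y \<in> A\<close>])
  qed
  have part: "partition_on A (orbit f ` A)"
  proof (rule partition_onI)
    show "\<Union> (orbit f ` A) = A" using orbit f by auto
    show "disjnt p q" if "p \<in> orbit f ` A" "q \<in> orbit f ` A" "p \<noteq> q" for p q
      using that by (auto simp: disjnt_iff dest: same)
    show "{} \<notin> orbit f ` A" using orbit by auto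
  qed
  have "4 * card (orbit f ` A) = card (\<Union> (orbit f ` A))"
  proof (rule card_partition)
    show "finite (orbit f ` A)" using \<open>finite A\<close> by simp
    show "finite (\<Union> (orbit f ` A))" using \<open>finite A\<close> partition_onD1[OF part] by simp
    show "card c = 4" if "c \<in> orbit f ` A" for c using that card4 by auto
    show "c \<inter> d = {}" if "c \<in> orbit f ` A" "d \<in> orbit f ` A" "c \<noteq> d" for c d
      using partition_onD2[OF part] that by (auto simp: disjoint_def)
  qed
  then have "card (orbit f ` A) = n"
    using partition_onD1[OF part] assms(2) by simp
  then show ?thesis
    using part card4 by (auto simp: partitions_into_orbits_def)
qed

section \<open>Explicit determinants and the finite index types\<close>

lemma det_4:
  "det (A :: 'a::comm_ring_1^4^4) =
    A$1$1 * A$2$2 * A$3$3 * A$4$4 - A$1$1 * A$2$2 * A$3$4 * A$4$3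
    - A$1$1 * A$2$3 * A$3$2 * A$4$4 + A$1$1 * A$2$3 * A$3$4 * A$4$2
    + A$1$1 * A$2$4 * A$3$2 * A$4$3 - A$1$1 * A$2$4 * A$3$3 * A$4$2
    - A$1$2 * A$2$1 * A$3$3 * A$4$4 + A$1$2 * A$2$1 * A$3$4 * A$4$3
    + A$1$2 * A$2$3 * A$3$1 * A$4$4 - A$1$2 * A$2$3 * A$3$4 * A$4$1
    - A$1$2 * A$2$4 * A$3$1 * A$4$3 + A$1$2 * A$2$4 * A$3$3 * A$4$1
    + A$1$3 * A$2$1 * A$3$2 * A$4$4 - A$1$3 * A$2$1 * A$3$4 * A$4$2
    - A$1$3 * A$2$2 * A$3$1 * A$4$4 + A$1$3 * A$2$2 * A$3$4 * A$4$1
    + A$1$3 * A$2$4 * A$3$1 * A$4$2 - A$1$3 * A$2$4 * A$3$2 * A$4$1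
    - A$1$4 * A$2$1 * A$3$2 * A$4$3 + A$1$4 * A$2$1 * A$3$3 * A$4$2
    + A$1$4 * A$2$2 * A$3$1 * A$4$3 - A$1$4 * A$2$2 * A$3$3 * A$4$1
    - A$1$4 * A$2$3 * A$3$1 * A$4$2 + A$1$4 * A$2$3 * A$3$2 * A$4$1"
proof -
  have f1: "finite {2::4, 3, 4}" "1 \<notin> {2::4, 3, 4}" by auto
  have f2: "finite {3::4, 4}" "2 \<notin> {3::4, 4}" by auto
  have f3: "finite {4::4}" "3 \<notin> {4::4}" by auto
  show ?thesis
    \<comment> \<open>The permutations of four indices are enumerated by splitting off one index at
      a time.\<close>
    unfolding det_def UNIV_4
    unfolding sum_over_permutations_insert[OF f1]
    unfolding sum_over_permutations_insert[OF f2]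
    unfolding sum_over_permutations_insert[OF f3]
    unfolding permutes_sing
    by (simp add: sign_swap_id permutation_swap_id permutation_compose sign_compose sign_id swap_id_eq
        algebra_simps)
qed

lemma exhaust_6: "x = 1 \<or> x = 2 \<or> x = 3 \<or> x = 4 \<or> x = 5 \<or> x = (6::6)"
proof (induct x)
  case (of_int z)
  then have "z = 0 \<or> z = 1 \<or> z = 2 \<or> z = 3 \<or> z = 4 \<or> z = 5" by auto
  then show ?case by auto
qed

lemma forall_6: "(\<forall>i::6. P i) \<longleftrightarrow> P 1 \<and> P 2 \<and> P 3 \<and> P 4 \<and> P 5 \<and> P 6"
  by (metis exhaust_6)

lemma vector_4 [simp]:
  "(vector [a, b, c, d] :: 'a::zero^4) $ 1 = a"
  "(vector [a, b, c, d] :: 'a::zero^4) $ 2 = b"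
  "(vector [a, b, c, d] :: 'a::zero^4) $ 3 = c"
  "(vector [a, b, c, d] :: 'a::zero^4) $ 4 = d"
  unfolding vector_def by simp_all

lemma vector_6 [simp]:
  "(vector [a, b, c, d, e, f] :: 'a::zero^6) $ 1 = a"
  "(vector [a, b, c, d, e, f] :: 'a::zero^6) $ 2 = b"
  "(vector [a, b, c, d, e, f] :: 'a::zero^6) $ 3 = c"
  "(vector [a, b, c, d, e, f] :: 'a::zero^6) $ 4 = d"
  "(vector [a, b, c, d, e, f] :: 'a::zero^6) $ 5 = e"
  "(vector [a, b, c, d, e, f] :: 'a::zero^6) $ 6 = f"
  unfolding vector_def by simp_all

section \<open>The relations with a sign parameter\<close>

text \<open>A multiple of the empty word is a scalar of the free algebra, so \<open>s\<close> enters
  as a coefficient, in the second and fifth relations only.\<close>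

definition rels :: "'a::field \<Rightarrow> 'a presentation"
  where "rels s = vector
    [gen 1 * gen 2 - gen 3 ^ 2,
     gen 2 * gen 1 - Poly_Mapping.single (Word []) s * gen 4 ^ 2,
     gen 1 * gen 3 - gen 2 * gen 4,
     gen 2 * gen 3 - gen 3 * gen 1,
     gen 1 * gen 4 - Poly_Mapping.single (Word []) s * gen 4 * gen 2,
     gen 3 * gen 2 - gen 4 * gen 1]"

lemma rels_S_eq: "rels_S = rels 1"
  and rels_T_eq: "rels_T = rels (- 1)"
  by (simp_all add: rels_S_def rels_T_def rels_def zero_ncmonom_def[symmetric] single_uminus)

lemma rel_matrix_rels:
  "rel_matrix (rels s) $ 1 = vector [0, Var 1, - Var 3, 0]"
  "rel_matrix (rels s) $ 2 = vector [Var 2, 0, 0, - (Const s * Var 4)]"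
  "rel_matrix (rels s) $ 3 = vector [0, 0, Var 1, - Var 2]"
  "rel_matrix (rels s) $ 4 = vector [- Var 3, 0, Var 2, 0]"
  "rel_matrix (rels s) $ 5 = vector [0, - (Const s * Var 4), 0, Var 1]"
  "rel_matrix (rels s) $ 6 = vector [- Var 4, Var 3, 0, 0]"
  unfolding rel_matrix_def rel_coeff_def rels_def gen_def
  by (simp_all add: vec_eq_iff forall_4 sum_4 lookup_minus lookup_single mult_single
      power2_eq_square Const_uminus)

text \<open>In the types \<open>4\<close> and \<open>6\<close> the top numeral is zero and hence
  least: the rows of \<open>M\<close> are ordered 6, 1, 2, 3, 4, 5.\<close>

lemma not_less_4: "\<not> (2::4) < 1" "\<not> (3::4) < 1" "\<not> (3::4) < 2"
    "\<not> (1::4) < 4" "\<not> (2::4) < 4" "\<not> (3::4) < 4"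
  by (simp_all add: less_bit0_def bit0.Rep_numeral bit0.Rep_1)

lemma less_6: "(1::6) < 2" "(1::6) < 3" "(1::6) < 4" "(2::6) < 3" "(2::6) < 4" "(2::6) < 5"
    "(3::6) < 4" "(3::6) < 5" "(4::6) < 5" "(6::6) < 1" "(6::6) < 2" "(6::6) < 3"
  by (simp_all add: less_bit0_def bit0.Rep_numeral bit0.Rep_1)

text \<open>Row \<open>r4\<close> comes last although it is the least one, because \<open>4 = 0\<close> in the type \<open>4\<close>.\<close>

lemma minor_mem_point_scheme:
  assumes "r4 < r1" "r1 < r2" "r2 < r3"
  shows "det (vector [rel_matrix R $ r1, rel_matrix R $ r2, rel_matrix R $ r3, rel_matrix R $ r4])
    \<in> point_scheme R"
proof -
  define \<sigma> :: "4 \<Rightarrow> 6" where "\<sigma> i = vector [r1, r2, r3, r4] $ i" for i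
  have "strict_mono \<sigma>"
    using assms unfolding strict_mono_def forall_4
    by (auto simp: \<sigma>_def not_less_4 intro: order.strict_trans)
  moreover have "(\<chi> i j. rel_matrix R $ \<sigma> i $ j)
      = vector [rel_matrix R $ r1, rel_matrix R $ r2, rel_matrix R $ r3, rel_matrix R $ r4]"
    by (simp add: vec_eq_iff forall_4 \<sigma>_def)
  ultimately show ?thesis unfolding point_scheme_def by force
qed

text \<open>Twelve of the fifteen minors. They are later paired off into six combinations, each
  minor being used once.\<close>

lemma minors_rels:
  fixes s :: "'a::field"
  assumes "s^2 = 1"
  defines "F \<equiv> point_scheme (rels s)"
    and "a \<equiv> Var 1" and "b \<equiv> Var 2" and "c \<equiv> Var 3" and "d \<equiv> Var 4" and "S \<equiv> Const s"
  shows "a * b^3 - S * a^2 * c * d \<in> F"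
    and "a^3 * b - S * b^2 * c * d \<in> F"
    and "a^3 * c - S * b * c^2 * d \<in> F"
    and "a^3 * d - S * b * c * d^2 \<in> F"
    and "a^2 * b * d - a * c^3 \<in> F"
    and "a^2 * b * c - a * d^3 \<in> F"
    and "a * b^2 * d - b * c^3 \<in> F"
    and "b^3 * c - S * a * c^2 * d \<in> F"
    and "a * b^2 * c - b * d^3 \<in> F"
    and "S * b^3 * d - a * c * d^2 \<in> F"
    and "S * a * b * d^2 - S * c^3 * d \<in> F"
    and "a * b * c^2 - c * d^3 \<in> F"
proof -
  have "Const s * (Const s * x) = x" for x
    using assms(1) by (simp add: mult.assoc[symmetric] Const_mult[symmetric] power2_eq_square)
  note simps = this det_4 rel_matrix_rels algebra_simps power2_eq_square power3_eq_cube
  \<comment> \<open>The first four arguments are the rows in increasing order, so row 6 comes first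
    whenever it occurs.\<close>
  note minor = minor_mem_point_scheme[of _ _ _ _ "rels s", folded F_def]
  show "a * b^3 - S * a^2 * c * d \<in> F"
    using minor[of 1 2 3 4] unfolding a_def b_def c_def d_def S_def by (simp add: simps less_6)
  show "a^3 * b - S * b^2 * c * d \<in> F"
    using minor[of 1 2 3 5] unfolding a_def b_def c_def d_def S_def by (simp add: simps less_6)
  show "a^3 * c - S * b * c^2 * d \<in> F"
    using minor[of 1 3 4 5] unfolding a_def b_def c_def d_def S_def by (simp add: simps less_6)
  show "a^3 * d - S * b * c * d^2 \<in> F"
    using minor[of 6 1 3 5] unfolding a_def b_def c_def d_def S_def by (simp add: simps less_6)
  show "a^2 * b * d - a * c^3 \<in> F"
    using minor[of 6 1 4 5] unfolding a_def b_def c_def d_def S_def by (simp add: simps less_6)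
  show "a^2 * b * c - a * d^3 \<in> F"
    using minor[of 6 2 3 5] unfolding a_def b_def c_def d_def S_def by (simp add: simps less_6)
  show "a * b^2 * d - b * c^3 \<in> F"
    using minor[of 6 1 3 4] unfolding a_def b_def c_def d_def S_def by (simp add: simps less_6)
  show "b^3 * c - S * a * c^2 * d \<in> F"
    using minor[of 6 2 3 4] unfolding a_def b_def c_def d_def S_def by (simp add: simps less_6)
  show "a * b^2 * c - b * d^3 \<in> F"
    using minor[of 6 2 4 5] unfolding a_def b_def c_def d_def S_def by (simp add: simps less_6)
  show "S * b^3 * d - a * c * d^2 \<in> F"
    using minor[of 2 3 4 5] unfolding a_def b_def c_def d_def S_def by (simp add: simps less_6)
  show "S * a * b * d^2 - S * c^3 * d \<in> F"
    using minor[of 6 1 2 4] unfolding a_def b_def c_def d_def S_def by (simp add: simps less_6)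
  show "a * b * c^2 - c * d^3 \<in> F"
    using minor[of 6 1 2 5] unfolding a_def b_def c_def d_def S_def by (simp add: simps less_6)
qed

text \<open>The multipliers make the mixed terms of two minors agree, for instance
  \<open>S * a^2 * b^2 * c * d\<close> in the first case. These cancel and leave a binomial in two
  variables only.\<close>

lemma binomials_mem_ideal_gen:
  fixes s :: "'a::field"
  assumes "s^2 = 1"
  defines "I \<equiv> ideal_gen (point_scheme (rels s))"
    and "a \<equiv> Var 1" and "b \<equiv> Var 2" and "c \<equiv> Var 3" and "d \<equiv> Var 4" and "S \<equiv> Const s"
  shows "a * b^5 - a^5 * b \<in> I" and "a * c^5 - S * a^5 * c \<in> I" and "a * d^5 - S * a^5 * d \<in> I"
    and "b * c^5 - S * b^5 * c \<in> I" and "b * d^5 - S * b^5 * d \<in> I" and "c * d^5 - c^5 * d \<in> I"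
proof -
  have S2: "S * S = 1"
    using assms(1) by (simp add: S_def Const_mult[symmetric] power2_eq_square)
  have S3: "S * (S * x) = x" for x
    using S2 by (metis mult.assoc mult_1)
  note m = minors_rels[OF assms(1), THEN ideal_gen_base,
      folded a_def b_def c_def d_def S_def, folded I_def]
  have comb: "p * f - q * g \<in> I" if "f \<in> I" "g \<in> I" for p q f g
    unfolding I_def using that by (intro ideal_gen_diff ideal_gen_mult) (simp_all add: I_def)
  note simps = algebra_simps eval_nat_numeral S3
  show "a * b^5 - a^5 * b \<in> I"
    using comb[OF m(1,2), of "b^2" "a^2"] by (simp add: simps)
  show "a * c^5 - S * a^5 * c \<in> I"
    using comb[OF m(5,3), of "- (c^2)" "S * a^2"] by (simp add: simps)
  show "a * d^5 - S * a^5 * d \<in> I"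
    using comb[OF m(6,4), of "- (d^2)" "S * a^2"] by (simp add: simps)
  show "b * c^5 - S * b^5 * c \<in> I"
    using comb[OF m(7,8), of "- (c^2)" "S * b^2"] by (simp add: simps)
  show "b * d^5 - S * b^5 * d \<in> I"
    using comb[OF m(9,10), of "- (d^2)" "b^2"] by (simp add: simps)
  show "c * d^5 - c^5 * d \<in> I"
    using comb[OF m(12,11), of "- (d^2)" "- S * c^2"] by (simp add: simps)
qed

text \<open>Set \<open>x = 1\<close>. The cofactor of \<open>x - 1\<close> comes from
  \<open>x^5 - 1 = (x - 1) * (1 + x + x^2 + x^3 + x^4)\<close>.\<close>

lemma dehomogenize_binomial:
  fixes x y :: "'a::field poly4"
  assumes "x - 1 \<in> ideal_gen B" and "x * y^5 - e * x^5 * y \<in> ideal_gen B"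
  shows "y^5 - e * y \<in> ideal_gen B"
proof -
  have "y^5 - e * y
      = (x * y^5 - e * x^5 * y) - (y^5 - e * y * (1 + x + x^2 + x^3 + x^4)) * (x - 1)"
    by (simp add: algebra_simps eval_nat_numeral)
  also have "\<dots> \<in> ideal_gen B"
    by (intro ideal_gen_diff ideal_gen_mult assms)
  finally show ?thesis .
qed

text \<open>A fourth root \<open>\<gamma>\<close> of \<open>s\<close> makes
  \<open>y^5 - s * y\<close> split. It is 1 for \<open>s = 1\<close> and \<open>\<zeta>\<close> for
  \<open>s = -1\<close>, and \<open>\<iota>\<close> is \<open>\<zeta>^2\<close> in both
  cases.\<close>

locale rels_family =
  fixes s \<gamma> \<iota> :: "'a::field_char_0"
  assumes \<iota>2: "\<iota>^2 = -1" and \<gamma>4: "\<gamma>^4 = s" and s2: "s^2 = 1"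
begin

section \<open>Fourth roots and reducedness of the point scheme\<close>

lemma ss: "s * s = 1"
  using s2 by (simp add: power2_eq_square)

lemma \<gamma>_nonzero: "\<gamma> \<noteq> 0"
  using \<gamma>4 s2 by auto

lemma fourth_roots:
  fixes g :: 'a
  shows "{x. x^4 = g^4} = {g, - g, g * \<iota>, - (g * \<iota>)}"
proof -
  have "x^4 - g^4 = (x - g) * (x + g) * ((x - g * \<iota>) * (x + g * \<iota>))" for x
  proof -
    have 1: "\<iota> * \<iota> = - 1"
      using \<iota>2 by (simp add: power2_eq_square)
    have 2: "\<iota> * (\<iota> * y) = - y" for y
      by (simp add: 1 mult.assoc[symmetric])
    show ?thesis by (simp add: 1 2 algebra_simps eval_nat_numeral)
  qed
  then have "x^4 = g^4 \<longleftrightarrow> x = g \<or> x = - g \<or> x = g * \<iota> \<or> x = - (g * \<iota>)" for x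
    by (subst eq_iff_diff_eq_0) (simp only: mult_eq_0_iff right_minus_eq add_eq_0_iff2 disj_assoc)
  then show ?thesis by auto
qed

text \<open>Zero is listed too, because the five elements are the roots of
  \<open>y^5 - g^4 * y\<close>. Characteristic zero separates \<open>g\<close> from
  \<open>- g\<close>.\<close>

lemma fourth_roots_distinct:
  fixes g :: 'a
  assumes "g \<noteq> 0"
  shows "distinct [0, g, - g, g * \<iota>, - (g * \<iota>)]"
proof -
  have "\<iota> \<noteq> 0" "\<iota> \<noteq> 1" "\<iota> \<noteq> - 1" using \<iota>2 by auto
  moreover have "g + g \<noteq> 0" "g * \<iota> + g * \<iota> \<noteq> 0"
    using assms \<open>\<iota> \<noteq> 0\<close> by (simp_all add: mult_2[symmetric])
  moreover have "g \<noteq> - (g * \<iota>)" "- g \<noteq> g * \<iota>"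
    using assms \<open>\<iota> \<noteq> - 1\<close> by (metis minus_minus mult_cancel_left mult_minus1_right mult_minus_right)+
  ultimately show ?thesis using assms by (auto simp: eq_neg_iff_add_eq_0)
qed

lemma card_fourth_roots: "(g :: 'a) \<noteq> 0 \<Longrightarrow> card {x. x^4 = g^4} = 4"
  unfolding fourth_roots using fourth_roots_distinct[of g] by simp

lemma prod_fourth_roots:
  fixes g :: 'a
  assumes "g \<noteq> 0"
  shows "(\<Prod>\<alpha>\<in>insert 0 {x. x^4 = g^4}. X - Const \<alpha>) = X^5 - Const (g^4) * X"
proof -
  have 1: "Const \<iota> * Const \<iota> = - 1"
    using \<iota>2 by (simp add: Const_mult[symmetric] Const_uminus power2_eq_square)
  have 2: "Const \<iota> * (Const \<iota> * y) = - y" for y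
    by (simp add: 1 mult.assoc[symmetric])
  have "X * ((X - Const g) * ((X + Const g) *
      ((X - Const g * Const \<iota>) * (X + Const g * Const \<iota>)))) = X^5 - Const g ^ 4 * X"
    by (simp add: 1 2 algebra_simps eval_nat_numeral)
  then show ?thesis
    unfolding fourth_roots using fourth_roots_distinct[OF assms]
    by (simp add: Const_uminus Const_mult Const_power)
qed

text \<open>On each chart the binomials give every other coordinate a split polynomial with distinct
  roots, so the criterion for radical ideals applies.\<close>

lemma reduced_scheme_rels: "reduced_scheme (point_scheme (rels s))"
  unfolding reduced_scheme_def chart_ideal_def
proof
  fix i :: 4
  let ?B = "point_scheme (rels s) \<union> {Var i - 1}"
  have B: "ideal_gen (point_scheme (rels s)) \<subseteq> ideal_gen ?B"
    by (rule ideal_gen_mono) blast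
  have one: "Var i - 1 \<in> ideal_gen ?B" by (simp add: ideal_gen_base)
  \<comment> \<open>The binomials are available for one order of each pair of variables. As
    \<open>e * e = 1\<close>, multiplying by \<open>- e\<close> exchanges the two variables.\<close>
  have flip: "y * x^5 - Const e * y^5 * x \<in> ideal_gen ?B"
    if "x * y^5 - Const e * x^5 * y \<in> ideal_gen ?B" "e * e = 1" for x y e
  proof -
    have "- Const e * (x * y^5 - Const e * x^5 * y) \<in> ideal_gen ?B"
      using that by (intro ideal_gen_mult)
    moreover have "Const e * (Const e * z) = z" for z
      using that(2) by (simp add: mult.assoc[symmetric] Const_mult[symmetric])
    ultimately show ?thesis by (simp add: algebra_simps)
  qed
  note bin = binomials_mem_ideal_gen[OF s2, THEN subsetD[OF B]]
  have "\<exists>e\<in>{1, s}. Var i * Var j ^ 5 - Const e * Var i ^ 5 * Var j \<in> ideal_gen ?B" if "j \<noteq> i" for j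
    using exhaust_4[of i] exhaust_4[of j] that bin
      flip[of _ _ 1] flip[of _ _ s, OF _ ss]
    by auto
  then have "\<exists>e\<in>{1, s}. Var j ^ 5 - Const e * Var j \<in> ideal_gen ?B" if "j \<noteq> i" for j
    using that dehomogenize_binomial[OF one] by blast
  \<comment> \<open>Both possible values of \<open>e\<close> are fourth powers:
    \<open>1 = 1^4\<close> and \<open>s = \<gamma>^4\<close>.\<close>
  then have "\<exists>g. g \<noteq> 0 \<and> Var j ^ 5 - Const (g^4) * Var j \<in> ideal_gen ?B" if "j \<noteq> i" for j
    using that \<gamma>4 \<gamma>_nonzero by (metis empty_iff insert_iff one_neq_zero power_one)
  then obtain g where g: "g j \<noteq> 0" "Var j ^ 5 - Const (g j ^ 4) * Var j \<in> ideal_gen ?B"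
    if "j \<noteq> i" for j
    by metis
  define A where "A j = (if j = i then {1} else insert 0 {x. x^4 = g j ^ 4})" for j
  show "radical_ideal (ideal_gen ?B)"
  proof (rule radical_ideal_if_split_univariate)
    show "finite (A j)" for j by (simp add: A_def fourth_roots)
    show "(\<Prod>\<alpha>\<in>A j. Var j - Const \<alpha>) \<in> ideal_gen ?B" for j
    proof (cases "j = i")
      case True
      then show ?thesis using one by (simp add: A_def)
    next
      case False
      then show ?thesis using g(2)[OF False]
        by (simp add: A_def prod_fourth_roots[OF g(1)[OF False]] del: prod.insert)
    qed
  qed
qed

end

section \<open>Closed points and the kernel map\<close>

lemma line_self: "v \<in> line v"
  unfolding line_def by (metis rangeI vec.scale_one)

lemma line_eq_if_mem:
  assumes "w \<in> line v" "w \<noteq> 0"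
  shows "line w = line v"
proof -
  obtain c where w: "w = c *s v" using assms(1) by (auto simp: line_def)
  then have "c \<noteq> 0" using assms(2) by auto
  then have "x *s v = (x / c) *s w" for x by (simp add: w)
  then have "line v \<subseteq> line w" unfolding line_def by blast
  moreover have "line w \<subseteq> line v" by (auto simp: line_def w)
  ultimately show ?thesis by simp
qed

lemma P3_E:
  assumes "p \<in> P3"
  obtains v where "v \<noteq> 0" "p = line v"
  using assms by (auto simp: P3_def)

lemma line_mem_P3: "v \<noteq> 0 \<Longrightarrow> line v \<in> P3"
  by (auto simp: P3_def)

text \<open>The entries of \<open>M(v) w\<close> are the multilinearized relations; this links the
  kernel in \<open>tau\<close> with the incidence in \<open>Gamma\<close>.\<close>

lemma rel_matrix_at_mult_nth:
  "(rel_matrix_at R v *v w) $ r = (\<Sum>i\<in>UNIV. \<Sum>j\<in>UNIV. rel_coeff R r i j * v $ i * w $ j)"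
proof -
  have "(rel_matrix_at R v *v w) $ r = (\<Sum>j\<in>UNIV. \<Sum>i\<in>UNIV. rel_coeff R r i j * v $ i * w $ j)"
    by (simp add: matrix_vector_mult_def rel_matrix_at_def rel_matrix_def eval4_sum eval4_mult
        sum_distrib_right)
  also have "\<dots> = (\<Sum>i\<in>UNIV. \<Sum>j\<in>UNIV. rel_coeff R r i j * v $ i * w $ j)"
    by (rule sum.swap)
  finally show ?thesis .
qed

lemma rel_matrix_at_scale_mult: "rel_matrix_at R (c *s v) *v w = c *s (rel_matrix_at R v *v w)"
  by (simp add: vec_eq_iff rel_matrix_at_mult_nth sum_distrib_left mult_ac)

text \<open>By homogeneity the kernel condition at \<open>v\<close> implies it at every multiple of
  \<open>v\<close>, so one representative suffices.\<close>

lemma tau_line: "tau R (line v) = {w. rel_matrix_at R v *v w = 0}"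
proof -
  have "rel_matrix_at R u *v w = 0" if "u \<in> line v" "rel_matrix_at R v *v w = 0" for u w
    using that by (auto simp: line_def rel_matrix_at_scale_mult)
  then show ?thesis using line_self[of v] unfolding tau_def by blast
qed

text \<open>A nonzero kernel vector of \<open>M(v)\<close> is also killed by any four of its rows,
  which makes every minor vanish.\<close>

lemma line_mem_closed_points_if_kernel:
  assumes "v \<noteq> 0" "w \<noteq> 0" and w: "rel_matrix_at R v *v w = 0"
  shows "line v \<in> closed_points (point_scheme R)"
proof -
  have "eval4 u f = 0" if u: "u \<in> line v" and f: "f \<in> point_scheme R" for u f
  proof -
    obtain \<sigma> :: "4 \<Rightarrow> 6" where f: "f = det (\<chi> i j. rel_matrix R $ \<sigma> i $ j)"
      using f by (auto simp: point_scheme_def)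
    have u0: "rel_matrix_at R u *v w = 0"
      using u w by (auto simp: line_def rel_matrix_at_scale_mult)
    define N where "N = (\<chi> i. rel_matrix_at R u $ \<sigma> i)"
    have "(N *v w) $ i = (rel_matrix_at R u *v w) $ \<sigma> i" for i
      by (simp add: N_def matrix_vector_mult_def)
    then have "N *v w = 0" using u0 by (simp add: vec_eq_iff)
    then have "\<not> invertible N"
      using \<open>w \<noteq> 0\<close> by (metis invertible_def matrix_left_invertible_ker)
    then have "det N = 0" by (simp add: invertible_det_nz)
    moreover have "N = (\<chi> i j. eval4 u (rel_matrix R $ \<sigma> i $ j))"
      by (simp add: N_def vec_eq_iff rel_matrix_at_def)
    ultimately show "eval4 u f = 0" by (simp add: f eval4_det)
  qed
  then show ?thesis using \<open>v \<noteq> 0\<close> by (simp add: closed_points_def line_mem_P3)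
qed

text \<open>Bijectivity implies the rest. Since \<open>tau R p\<close> is again a point, the kernel
  of \<open>M(p)\<close> is a line: this gives rank three, and any \<open>q\<close> paired with
  \<open>p\<close> in \<open>Gamma\<close> must be that line.\<close>

lemma tau_automorphism_if_bij:
  assumes bij: "bij_betw (tau R) (closed_points (point_scheme R)) (closed_points (point_scheme R))"
  shows "tau_automorphism R"
  unfolding tau_automorphism_def
proof (intro conjI ballI impI bij)
  let ?P = "closed_points (point_scheme R)"
  have P3: "p \<in> P3" if "p \<in> ?P" for p using that by (simp add: closed_points_def)
  have tau_P: "tau R p \<in> ?P" if "p \<in> ?P" for p using bij_betwE[OF bij] that by blast
  show "rank (rel_matrix_at R v) = 3" if p: "p \<in> ?P" and v: "v \<in> p" "v \<noteq> 0" for p v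
  proof -
    have "p = line v"
      using P3[OF p] v line_eq_if_mem by (metis P3_E)
    moreover obtain w where "w \<noteq> 0" "tau R p = line w"
      using P3[OF tau_P[OF p]] by (rule P3_E)
    ultimately have "w \<noteq> 0" "{x. rel_matrix_at R v *v x = 0} = line w"
      by (simp_all add: tau_line)
    then have "rank (rel_matrix_at R v) + 1 = CARD(4)"
      unfolding line_def by (rule rank_eq_if_kernel_line)
    then show ?thesis by simp
  qed
  show "Gamma R = {(p, tau R p) | p. p \<in> ?P}"
  proof (intro set_eqI iffI)
    fix x assume "x \<in> Gamma R"
    then obtain p q where x: "x = (p, q)" "p \<in> P3" "q \<in> P3"
      and 0: "\<And>v w r. v \<in> p \<Longrightarrow> w \<in> q \<Longrightarrow> (rel_matrix_at R v *v w) $ r = 0"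
      by (auto simp: Gamma_def rel_matrix_at_mult_nth)
    obtain v w where v: "v \<noteq> 0" "p = line v" and w: "w \<noteq> 0" "q = line w"
      using x by (auto simp: P3_def)
    have vw: "rel_matrix_at R v *v w = 0"
      using 0[of v w] v w line_self by (auto simp: vec_eq_iff)
    then have p: "p \<in> ?P" using v w by (simp add: line_mem_closed_points_if_kernel)
    have "w \<in> tau R p" using vw v by (simp add: tau_line)
    then have "q = tau R p"
      using P3[OF tau_P[OF p]] w line_eq_if_mem by (metis P3_E)
    then show "x \<in> {(p, tau R p) | p. p \<in> ?P}" using x p by blast
  next
    fix x assume "x \<in> {(p, tau R p) | p. p \<in> ?P}"
    then obtain p where p: "x = (p, tau R p)" "p \<in> ?P" by blast
    moreover have "(rel_matrix_at R v *v w) $ r = 0" if "v \<in> p" "w \<in> tau R p" for v w r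
      using that by (simp add: tau_def)
    ultimately show "x \<in> Gamma R"
      using P3 tau_P by (simp add: Gamma_def rel_matrix_at_mult_nth)
  qed
qed

lemma bij_betw_if_4_times:
  assumes "\<And>x. x \<in> A \<Longrightarrow> f x \<in> A" "\<And>x. x \<in> A \<Longrightarrow> f (f (f (f x))) = x"
  shows "bij_betw f A A"
  by (rule bij_betw_byWitness[of _ "\<lambda>x. f (f (f x))"]) (use assms in auto)

section \<open>Coordinates of points and the kernel equations\<close>

lemma mem_line_vector:
  "w \<in> line (vector [1, x, y, z]) \<longleftrightarrow> w $ 2 = w $ 1 * x \<and> w $ 3 = w $ 1 * y \<and> w $ 4 = w $ 1 * z"
  unfolding line_def by (auto simp: image_iff vec_eq_iff forall_4)

lemma axis_nth_if: "axis k x $ i = (if i = k then x else 0)"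
  by (simp add: axis_def)

lemma mem_line_axis: "w \<in> line (axis k 1) \<longleftrightarrow> (\<forall>i. i \<noteq> k \<longrightarrow> w $ i = 0)"
proof
  assume "\<forall>i. i \<noteq> k \<longrightarrow> w $ i = 0"
  then have "w = w $ k *s axis k 1" by (auto simp: vec_eq_iff axis_def)
  then show "w \<in> line (axis k 1)" unfolding line_def by (rule range_eqI)
qed (auto simp: line_def axis_def)

lemma pt_eq_iff: "pt 1 x y z = pt 1 x' y' z' \<longleftrightarrow> x = x' \<and> y = y' \<and> z = z'"
proof
  assume "pt 1 x y z = pt 1 x' y' z'"
  then have "vector [1, x, y, z] \<in> line (vector [1, x', y', z'])"
    using line_self by (metis pt_def)
  then show "x = x' \<and> y = y' \<and> z = z'" by (simp add: mem_line_vector)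
qed simp

lemma e_pt_eq_iff: "(e_pt i :: 'a::field point) = e_pt j \<longleftrightarrow> i = j"
proof
  assume "(e_pt i :: 'a point) = e_pt j"
  then have "axis i 1 \<in> line (axis j 1 :: 'a^4)"
    using line_self by (metis e_pt_def)
  then show "i = j" by (auto simp: mem_line_axis axis_nth_if split: if_splits)
qed simp

lemma e_pt_eq_pt_iff: "e_pt i = pt 1 x y z \<longleftrightarrow> i = 1 \<and> x = 0 \<and> y = 0 \<and> z = 0"
proof
  assume "e_pt i = pt 1 x y z"
  then have "vector [1, x, y, z] \<in> line (axis i 1)"
    using line_self by (metis e_pt_def pt_def)
  then show "i = 1 \<and> x = 0 \<and> y = 0 \<and> z = 0"
    using exhaust_4[of i] by (auto simp: mem_line_axis forall_4)
next
  assume "i = 1 \<and> x = 0 \<and> y = 0 \<and> z = 0"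
  moreover have "axis 1 1 = (vector [1, 0, 0, 0] :: 'a^4)"
    by (simp add: vec_eq_iff forall_4 axis_def)
  ultimately show "e_pt i = pt 1 x y z" by (simp add: e_pt_def pt_def)
qed

lemma kernel_rels:
  "rel_matrix_at (rels s) v *v w = 0 \<longleftrightarrow>
    v $ 1 * w $ 2 = v $ 3 * w $ 3 \<and> v $ 2 * w $ 1 = s * v $ 4 * w $ 4 \<and>
    v $ 1 * w $ 3 = v $ 2 * w $ 4 \<and> v $ 2 * w $ 3 = v $ 3 * w $ 1 \<and>
    v $ 1 * w $ 4 = s * v $ 4 * w $ 2 \<and> v $ 3 * w $ 2 = v $ 4 * w $ 1"
  by (auto simp: vec_eq_iff forall_6 matrix_vector_mult_def sum_4 rel_matrix_at_def
      rel_matrix_rels eval4_uminus eval4_mult)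

lemma tau_rels_e_pt:
  assumes "s \<noteq> 0"
  shows "tau (rels s) (e_pt 1) = e_pt 1" and "tau (rels s) (e_pt 2) = e_pt 2"
    and "tau (rels s) (e_pt 3) = e_pt 4" and "tau (rels s) (e_pt 4) = e_pt 3"
  using assms by (auto simp: e_pt_def tau_line kernel_rels mem_line_axis forall_4 axis_nth_if)

section \<open>The sixteen torus points and the action of the kernel map on them\<close>

context rels_family
begin

text \<open>The fourth coordinate is \<open>s * inverse (b * c)\<close>, written without division.\<close>

definition torus_pt :: "'a \<Rightarrow> 'a \<Rightarrow> 'a point"
  where "torus_pt b c = pt 1 b c (b^3 * c^3)"

definition params :: "('a \<times> 'a) set"
  where "params = {b. b^4 = 1} \<times> {c. c^4 = s}"

definition vertices :: "'a point set"
  where "vertices = {e_pt 1, e_pt 2, e_pt 3, e_pt 4}"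

definition torus_points :: "'a point set"
  where "torus_points = case_prod torus_pt ` params"

lemma torus_pt_eq_iff: "torus_pt b c = torus_pt b' c' \<longleftrightarrow> b = b' \<and> c = c'"
  by (auto simp: torus_pt_def pt_eq_iff)

lemma inj_torus_pt: "inj (case_prod torus_pt)"
  by (auto intro!: injI simp: torus_pt_eq_iff)

lemma torus_pt_mem_torus_points_iff: "torus_pt b c \<in> torus_points \<longleftrightarrow> b^4 = 1 \<and> c^4 = s"
  by (auto simp: torus_points_def params_def torus_pt_eq_iff)

lemma fourth_roots_1: "{b. b^4 = 1} = {1, - 1, \<iota>, - \<iota>}"
  using fourth_roots[of 1] by simp

lemma fourth_roots_s: "{c. c^4 = s} = {\<gamma>, - \<gamma>, \<gamma> * \<iota>, - (\<gamma> * \<iota>)}"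
  using fourth_roots[of \<gamma>] by (simp add: \<gamma>4)

lemma finite_params: "finite params"
  by (simp add: params_def fourth_roots_1 fourth_roots_s)

lemma card_params: "card params = 16"
  using card_fourth_roots[of 1] card_fourth_roots[of \<gamma>] \<gamma>_nonzero
  by (simp add: params_def card_cartesian_product \<gamma>4)

lemma card_vertices: "card vertices = 4"
  by (simp add: vertices_def e_pt_eq_iff)

lemma vertices_Int_torus_points: "vertices \<inter> torus_points = {}"
  by (auto simp: vertices_def torus_points_def params_def torus_pt_def e_pt_eq_pt_iff)

lemma card_vertices_Un_torus_points: "card (vertices \<union> torus_points) = 20"
proof -
  have "card torus_points = 16"
    unfolding torus_points_def by (simp add: card_image inj_on_subset[OF inj_torus_pt] card_params)
  moreover have "finite vertices" "finite torus_points"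
    by (simp_all add: vertices_def torus_points_def finite_params)
  ultimately show ?thesis by (simp add: card_Un_disjoint vertices_Int_torus_points card_vertices)
qed

lemma s_power: "s * s * x = x" "s * (s * x) = x"
  using ss by (simp_all add: mult.assoc[symmetric])

text \<open>Each reduction occurs with and without a tail \<open>x\<close>, so that it rewrites
  fourth powers anywhere in a product nested to the right.\<close>

lemma fourth_power_reduce:
  assumes "b^4 = 1" "c^4 = s"
  shows "b * (b * (b * b)) = 1" "b * (b * (b * (b * x))) = x"
    and "c * (c * (c * c)) = s" "c * (c * (c * (c * x))) = s * x"
  using assms by (simp_all add: eval_nat_numeral mult.assoc[symmetric])

lemma tau_torus_pt:
  assumes b: "b^4 = 1" and c: "c^4 = s"
  shows "tau (rels s) (torus_pt b c) = torus_pt (b^3 * c^2) (b^3 * c)"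
proof -
  note reduce = fourth_power_reduce[OF b c]
  note simps = reduce s_power ss eval_nat_numeral mult_ac
  show ?thesis
  proof (intro set_eqI iffI)
    fix w assume "w \<in> tau (rels s) (torus_pt b c)"
    note ker = this[unfolded torus_pt_def pt_def tau_line mem_Collect_eq kernel_rels vector_4 mult_1]
    \<comment> \<open>Three of the six kernel equations determine \<open>w\<close> up to the scalar
      \<open>w $ 1\<close>; the converse inclusion checks all six.\<close>
    have w: "w $ 2 = c * w $ 3" "b * w $ 3 = c * w $ 1" "w $ 4 = s * (b^3 * c^3) * w $ 2"
      using ker by blast+
    have "w $ 3 = b^3 * (b * w $ 3)" by (simp add: simps)
    also have "\<dots> = w $ 1 * (b^3 * c)" by (subst w(2)) (simp add: mult_ac)
    finally have w3: "w $ 3 = w $ 1 * (b^3 * c)" .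
    have w2: "w $ 2 = w $ 1 * (b^3 * c^2)" by (simp add: w(1) w3 simps)
    have w4: "w $ 4 = w $ 1 * ((b^3 * c^2)^3 * (b^3 * c)^3)" by (simp add: w(3) w2 simps)
    show "w \<in> torus_pt (b^3 * c^2) (b^3 * c)"
      by (simp add: torus_pt_def pt_def mem_line_vector w2 w3 w4)
  next
    fix w assume "w \<in> torus_pt (b^3 * c^2) (b^3 * c)"
    then show "w \<in> tau (rels s) (torus_pt b c)"
      by (simp add: torus_pt_def pt_def mem_line_vector tau_line kernel_rels simps)
  qed
qed

text \<open>The fourth coordinate is \<open>b^18 * c^9\<close>, where \<open>b^4 = 1\<close> and
  \<open>c^8 = s^2 = 1\<close>.\<close>

lemma torus_pt_tau_params_eq_pt:
  assumes "b^4 = 1" "c^4 = s"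
  shows "torus_pt (b^3 * c^2) (b^3 * c) = pt 1 (b^3 * c^2) (b^3 * c) (b^2 * c)"
proof -
  note reduce = fourth_power_reduce[OF assms]
  show ?thesis
    by (simp add: torus_pt_def pt_eq_iff reduce s_power ss eval_nat_numeral mult_ac)
qed

text \<open>Here \<open>b^3\<close> and \<open>s * c^3\<close> are the inverses of \<open>b\<close>
  and \<open>c\<close>, so the square of the map is inversion of the parameters.\<close>

lemma tau_tau_torus_pt:
  assumes b: "b^4 = 1" and c: "c^4 = s"
  shows "(b^3 * c^2)^4 = 1" "(b^3 * c)^4 = s"
    and "tau (rels s) (tau (rels s) (torus_pt b c)) = torus_pt (b^3) (s * c^3)"
    and "tau (rels s) (tau (rels s) (tau (rels s) (tau (rels s) (torus_pt b c)))) = torus_pt b c"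
proof -
  note reduce = fourth_power_reduce[OF b c]
  note simps = reduce s_power ss eval_nat_numeral mult_ac
  show 1: "(b^3 * c^2)^4 = 1" "(b^3 * c)^4 = s" by (simp_all add: simps)
  show 2: "tau (rels s) (tau (rels s) (torus_pt b c)) = torus_pt (b^3) (s * c^3)"
    using 1 by (simp add: tau_torus_pt b c) (simp add: torus_pt_eq_iff simps)
  have 3: "(b^3)^4 = 1" "(s * c^3)^4 = s" by (simp_all add: simps)
  have 4: "((b^3)^3 * (s * c^3)^2)^4 = 1" "((b^3)^3 * (s * c^3))^4 = s" by (simp_all add: simps)
  show "tau (rels s) (tau (rels s) (tau (rels s) (tau (rels s) (torus_pt b c)))) = torus_pt b c"
    unfolding 2 tau_torus_pt[OF 3] tau_torus_pt[OF 4] by (simp add: torus_pt_eq_iff simps)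
qed

lemma s_nonzero: "s \<noteq> 0"
  using ss by auto

lemmas tau_e_pt = tau_rels_e_pt[OF s_nonzero]

text \<open>The known images under \<open>tau\<close> provide nonzero kernel vectors at the listed
  points. Conversely, the minors are solved separately on the plane \<open>v $ 1 = 0\<close> and on
  the chart \<open>v $ 1 = 1\<close>.\<close>

lemma closed_points_rels: "closed_points (point_scheme (rels s)) = vertices \<union> torus_points"
proof (intro set_eqI iffI)
  fix p assume "p \<in> vertices \<union> torus_points"
  moreover have "e_pt k \<in> closed_points (point_scheme (rels s))"
    if "tau (rels s) (e_pt k) = e_pt l" for k l
  proof -
    have "axis l 1 \<in> tau (rels s) (e_pt k)" using that line_self[of "axis l 1"] by (simp add: e_pt_def)
    then show ?thesis unfolding e_pt_def
      by (intro line_mem_closed_points_if_kernel[of _ "axis l 1"]) (simp_all add: tau_line axis_eq_0_iff)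
  qed
  moreover have "torus_pt b c \<in> closed_points (point_scheme (rels s))" if "b^4 = 1" "c^4 = s" for b c
  proof -
    have nz: "vector [1, x, y, z] \<noteq> (0 :: 'a^4)" for x y z by (simp add: vec_eq_iff forall_4)
    have "vector [1, b^3 * c^2, b^3 * c, b^2 * c] \<in> tau (rels s) (torus_pt b c)"
      unfolding tau_torus_pt[OF that] torus_pt_tau_params_eq_pt[OF that] pt_def by (rule line_self)
    then show ?thesis unfolding torus_pt_def pt_def
      by (intro line_mem_closed_points_if_kernel[OF nz nz]) (simp add: tau_line)
  qed
  ultimately show "p \<in> closed_points (point_scheme (rels s))"
    using tau_e_pt by (auto simp: vertices_def torus_points_def params_def)
next
  fix p assume p: "p \<in> closed_points (point_scheme (rels s))"
  then obtain v where v: "v \<noteq> 0" "p = line v" by (auto simp: closed_points_def elim: P3_E)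
  note eval_simps = eval4_diff eval4_mult eval4_power
  have m: "eval4 u f = 0" if "u \<in> p" "f \<in> point_scheme (rels s)" for u f
    using p that by (simp add: closed_points_def)
  note m = m[OF _ minors_rels(1)[OF s2]] m[OF _ minors_rels(2)[OF s2]] m[OF _ minors_rels(3)[OF s2]]
    m[OF _ minors_rels(4)[OF s2]] m[OF _ minors_rels(5)[OF s2]] m[OF _ minors_rels(7)[OF s2]]
    m[OF _ minors_rels(9)[OF s2]] m[OF _ minors_rels(11)[OF s2]]
  note m = m[unfolded eval_simps eval4_Var eval4_Const]
  show "p \<in> vertices \<union> torus_points"
  proof (cases "v $ 1 = 0")
    case True
    have "v \<in> p" using v line_self by simp
    \<comment> \<open>With the first coordinate zero these three minors become
      \<open>b * c^3\<close>, \<open>b * d^3\<close> and \<open>c^3 * d\<close>, up to sign and the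
      unit \<open>s\<close>. Hence at most one coordinate survives.\<close>
    then have "v $ 2 * v $ 3 = 0" "v $ 2 * v $ 4 = 0" "v $ 3 * v $ 4 = 0"
      using True m(6-8)[of v] s_nonzero by (auto simp: power_eq_0_iff)
    then obtain k where "\<forall>i. i \<noteq> k \<longrightarrow> v $ i = 0" "k \<noteq> 1"
      using True unfolding forall_4 by (metis zero_neq_one mult_eq_0_iff)
    then have "p = e_pt k"
      using v line_eq_if_mem[of v "axis k 1"] by (simp add: mem_line_axis e_pt_def)
    then show ?thesis using exhaust_4[of k] by (auto simp: vertices_def)
  next
    case False
    define b c d where "b = v $ 2 / v $ 1" and "c = v $ 3 / v $ 1" and "d = v $ 4 / v $ 1"
    define u :: "'a^4" where "u = vector [1, b, c, d]"
    have "u = inverse (v $ 1) *s v"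
      using False by (simp add: vec_eq_iff forall_4 u_def b_def c_def d_def field_simps)
    then have "u \<in> p" unfolding v line_def by blast
    then have pu: "p = pt 1 b c d"
      using v line_eq_if_mem[of u v] by (simp add: pt_def u_def vec_eq_iff forall_4)
    have eqs: "b^3 = s * c * d" "b = s * b^2 * c * d" "c = s * b * c^2 * d" "d = s * b * c * d^2"
        "b * d = c^3"
      using m(1-5)[OF \<open>u \<in> p\<close>] by (simp_all add: u_def)
    show ?thesis
    proof (cases "b = 0")
      case True
      then have "c = 0" "d = 0" using eqs by auto
      then show ?thesis using True pu e_pt_eq_pt_iff[of 1 b c d] by (simp add: vertices_def)
    next
      case False
      \<comment> \<open>Cancelling \<open>b\<close> yields \<open>s * b * c * d = 1\<close>, from
        which both fourth powers and the value of \<open>d\<close> follow.\<close>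
      have "b * (s * b * c * d) = b * 1" using eqs(2) by (simp add: power2_eq_square mult_ac)
      then have 1: "s * b * c * d = 1" using False by simp
      have b4: "b^4 = 1"
      proof -
        have "b^4 = b * b^3" by (simp add: eval_nat_numeral)
        then show ?thesis using 1 eqs(1) by (simp add: mult_ac)
      qed
      have c4: "c^4 = s"
      proof -
        have "c^4 = c * c^3" by (simp add: eval_nat_numeral)
        also have "\<dots> = s * (s * b * c * d)" using s_power by (simp add: eqs(5)[symmetric] mult_ac)
        finally show ?thesis using 1 by simp
      qed
      \<comment> \<open>Inserting \<open>b^4 = 1\<close> and \<open>c^4 = s\<close> brings out the
        factor \<open>s * b * c * d = 1\<close>.\<close>
      have "d = s * s * d" by (simp add: s_power)
      also have "\<dots> = s * b^4 * c^4 * d" using b4 c4 by simp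
      also have "\<dots> = (s * b * c * d) * (b^3 * c^3)" by (simp add: eval_nat_numeral mult_ac)
      finally have "p = torus_pt b c" using 1 pu by (simp add: torus_pt_def)
      then show ?thesis using b4 c4 by (simp add: torus_pt_mem_torus_points_iff)
    qed
  qed
qed

section \<open>Periodicity of the kernel map and its orbits\<close>

lemma tau_4_times:
  "p \<in> vertices \<union> torus_points \<Longrightarrow>
    tau (rels s) (tau (rels s) (tau (rels s) (tau (rels s) p))) = p"
  using tau_tau_torus_pt(4) tau_e_pt by (auto simp: vertices_def torus_points_def params_def)

lemma tau_mem_torus_points: "p \<in> torus_points \<Longrightarrow> tau (rels s) p \<in> torus_points"
proof -
  assume "p \<in> torus_points"
  then obtain b c where "b^4 = 1" "c^4 = s" "p = torus_pt b c" by (auto simp: torus_points_def params_def)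
  then show ?thesis by (simp add: tau_torus_pt torus_pt_mem_torus_points_iff tau_tau_torus_pt(1,2))
qed

lemma tau_mem: "p \<in> vertices \<union> torus_points \<Longrightarrow> tau (rels s) p \<in> vertices \<union> torus_points"
  using tau_mem_torus_points tau_e_pt by (auto simp: vertices_def)

lemma tau_automorphism_rels: "tau_automorphism (rels s)"
proof (rule tau_automorphism_if_bij, unfold closed_points_rels)
  show "bij_betw (tau (rels s)) (vertices \<union> torus_points) (vertices \<union> torus_points)"
    by (rule bij_betw_if_4_times) (fact tau_mem tau_4_times)+
qed

text \<open>The parameters not fixed by inversion, that is, those moved by the square of
  \<open>tau\<close>.\<close>

definition moved_params :: "('a \<times> 'a) set"
  where "moved_params = {(b, c) \<in> params. \<not> (b^2 = 1 \<and> c^2 = 1)}"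

lemma partitions_moved_params_into_orbits:
  assumes "card moved_params = n * 4"
  shows "partitions_into_orbits (tau (rels s)) (case_prod torus_pt ` moved_params) n 4"
proof (rule partitions_into_orbits_of_size_4)
  let ?t = "tau (rels s)"
  show "finite (case_prod torus_pt ` moved_params)"
    by (rule finite_imageI, rule finite_subset[OF _ finite_params]) (auto simp: moved_params_def)
  show "card (case_prod torus_pt ` moved_params) = n * 4"
    using assms by (simp add: card_image inj_on_subset[OF inj_torus_pt])
  fix p assume "p \<in> case_prod torus_pt ` moved_params"
  then obtain b c where p: "p = torus_pt b c" and bc: "b^4 = 1" "c^4 = s" "\<not> (b^2 = 1 \<and> c^2 = 1)"
    by (auto simp: moved_params_def params_def)
  note reduce = fourth_power_reduce[OF bc(1,2)]
  note simps = reduce s_power ss eval_nat_numeral mult_ac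
  \<comment> \<open>The moved parameters are preserved: an image fixed by inversion would force
    \<open>b^2 = c^2 = s\<close>, hence \<open>s = c^4 = s^2 = 1\<close>, and \<open>(b, c)\<close>
    itself would be fixed.\<close>
  have "\<not> ((b^3 * c^2)^2 = 1 \<and> (b^3 * c)^2 = 1)"
  proof
    assume "(b^3 * c^2)^2 = 1 \<and> (b^3 * c)^2 = 1"
    then have 1: "s * b^2 = 1" "b^2 * c^2 = 1" by (simp_all add: simps)
    have b2: "b^2 = s" using arg_cong[OF 1(1), of "\<lambda>x. s * x"] by (simp add: s_power)
    have "c^2 = b^2 * (b^2 * c^2)" by (simp add: simps)
    then have c2: "c^2 = s" using b2 by (metis 1(2) mult_1_right)
    have "s = c^2 * c^2" using bc(2) by (simp add: eval_nat_numeral mult_ac)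
    then have "s = 1" using c2 ss by simp
    then show False using b2 c2 bc(3) by simp
  qed
  then have "(b^3 * c^2, b^3 * c) \<in> moved_params"
    using tau_tau_torus_pt(1,2)[OF bc(1,2)] by (simp add: moved_params_def params_def)
  then show "?t p \<in> case_prod torus_pt ` moved_params"
    unfolding p tau_torus_pt[OF bc(1,2)] by (rule rev_image_eqI) simp
  show "?t (?t (?t (?t p))) = p" unfolding p by (rule tau_tau_torus_pt(4)[OF bc(1,2)])
  show "?t (?t p) \<noteq> p"
  proof
    assume "?t (?t p) = p"
    then have 1: "b^3 = b" "s * c^3 = c" by (simp_all add: p tau_tau_torus_pt(3)[OF bc(1,2)] torus_pt_eq_iff)
    have "b^2 = b * b^3" by (simp add: 1 power2_eq_square)
    then have b2: "b^2 = 1" by (simp add: simps)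
    have "c^2 = c * (s * c^3)" by (simp only: 1 power2_eq_square)
    then have "c^2 = 1" by (simp add: simps)
    then show False using b2 bc(3) by simp
  qed
qed

section \<open>Powers of the fourth root of unity and subscripts modulo four\<close>

lemma \<iota>_power: "\<iota> \<noteq> 0" "\<iota>^3 = - \<iota>" "\<iota>^4 = 1"
proof -
  show "\<iota> \<noteq> 0" using \<iota>2 by auto
  have "\<iota>^3 = \<iota>^2 * \<iota>" "\<iota>^4 = \<iota>^2 * \<iota>^2" by (simp_all add: eval_nat_numeral mult_ac)
  then show "\<iota>^3 = - \<iota>" "\<iota>^4 = 1" by (simp_all add: \<iota>2)
qed

lemma \<iota>_powi_image: "(\<lambda>j. \<iota> powi j) ` {0..3} = {b. b^4 = 1}"
proof -
  have "{0..3} = {0, 1, 2, 3 :: int}" by auto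
  then show ?thesis unfolding fourth_roots_1 by (auto simp: power_int_def \<iota>2 \<iota>_power)
qed

lemma \<iota>_powi_4: "(\<iota> powi j)^4 = 1"
proof -
  have "(\<iota> powi j)^4 = (\<iota>^4) powi j"
    by (simp only: power_int_power power_int_power' mult.commute)
  then show ?thesis by (simp add: \<iota>_power)
qed

text \<open>The cube matches the division-free fourth coordinate \<open>b^3 * c^3\<close> of
  \<open>torus_pt\<close>.\<close>

lemma \<iota>_powi_minus: "\<iota> powi (- j) = (\<iota> powi j)^3"
proof -
  have "\<iota> powi j * (\<iota> powi j)^3 = 1" using \<iota>_powi_4[of j] by (simp add: eval_nat_numeral)
  then show ?thesis by (simp add: power_int_minus inverse_unique)
qed

lemma \<iota>_powi_mod: "\<iota> powi (j mod 4) = \<iota> powi j"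
proof -
  have "\<iota> powi j = \<iota> powi (4 * (j div 4) + j mod 4)" by simp
  also have "\<dots> = (\<iota>^4) powi (j div 4) * \<iota> powi (j mod 4)"
    by (simp only: power_int_add[OF disjI1[OF \<iota>_power(1)]] power_int_mult power_int_numeral)
  finally show ?thesis by (simp add: \<iota>_power)
qed

text \<open>The fourth roots of \<open>s\<close> are the multiples of \<open>\<gamma>\<close> by the
  fourth roots of unity.\<close>

lemma torus_points_eq:
  "torus_points = {torus_pt (\<iota> powi j) (\<gamma> * \<iota> powi k) | j k. j \<in> {0..3} \<and> k \<in> {0..3}}"
proof -
  have "{c. c^4 = s} = (\<lambda>c. \<gamma> * c) ` {b. b^4 = 1}"
    by (simp add: fourth_roots_1 fourth_roots_s)
  then have "params = (\<lambda>(j, k). (\<iota> powi j, \<gamma> * \<iota> powi k)) ` ({0..3} \<times> {0..3})"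
    unfolding params_def \<iota>_powi_image[symmetric] by auto
  then have "torus_points = (\<lambda>p. torus_pt (\<iota> powi fst p) (\<gamma> * \<iota> powi snd p)) ` ({0..3} \<times> {0..3})"
    by (simp add: torus_points_def image_image case_prod_unfold)
  then show ?thesis
    by (simp only: image_def Bex_def split_paired_Ex fst_conv snd_conv mem_Sigma_iff) blast
qed

text \<open>For \<open>\<gamma> = 1\<close> these are the points \<open>p_pt\<close>, for
  \<open>\<gamma> = \<zeta>\<close> the points \<open>q_pt\<close>.\<close>

lemma torus_pt_powi:
  "torus_pt (\<iota> powi j) (\<gamma> * \<iota> powi k)
    = pt 1 (\<iota> powi j) (\<gamma> * \<iota> powi k) (\<gamma>^3 * \<iota> powi (- j - k))"
proof -
  have "\<iota> powi (- j - k) = \<iota> powi (- j) * \<iota> powi (- k)"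
    using power_int_add[OF disjI1[OF \<iota>_power(1)], of "- j" "- k"] by simp
  then show ?thesis by (simp add: torus_pt_def pt_eq_iff \<iota>_powi_minus power_mult_distrib)
qed

text \<open>The factor \<open>\<gamma>^2\<close> is 1 in the first algebra and
  \<open>\<zeta>^2 = \<iota>\<close> in the second, where it shifts the first subscript by
  one.\<close>

lemma tau_torus_pt_powi:
  "tau (rels s) (torus_pt (\<iota> powi j) (\<gamma> * \<iota> powi k))
    = torus_pt (\<gamma>^2 * \<iota> powi (2 * k - j)) (\<gamma> * \<iota> powi ((k - j) mod 4))"
proof -
  note add = power_int_add[OF disjI1[OF \<iota>_power(1)]]
  have "\<iota> powi (2 * k - j) = (\<iota> powi k)^2 * (\<iota> powi j)^3"
    using add[of "2 * k" "- j"] by (simp add: \<iota>_powi_minus power_int_power' mult.commute)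
  moreover have "\<iota> powi (k - j) = \<iota> powi k * (\<iota> powi j)^3"
    using add[of k "- j"] by (simp add: \<iota>_powi_minus)
  moreover have "(\<gamma> * \<iota> powi k)^4 = s" by (simp add: power_mult_distrib \<gamma>4 \<iota>_powi_4)
  ultimately show ?thesis
    by (simp add: tau_torus_pt \<iota>_powi_4 torus_pt_eq_iff \<iota>_powi_mod power_mult_distrib mult_ac)
qed

lemma tau_explicit:
  assumes "pt 1 b c (s * (inverse b * inverse c)) \<in> torus_points"
  shows "tau (rels s) (pt 1 b c (s * (inverse b * inverse c))) = pt 1 (b^3 * c^2) (b^3 * c) (b^2 * c)"
proof -
  obtain b' c' where "b'^4 = 1" "c'^4 = s" "pt 1 b c (s * (inverse b * inverse c)) = torus_pt b' c'"
    using assms by (auto simp: torus_points_def params_def)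
  moreover from this have "b' = b" "c' = c" by (auto simp: torus_pt_def pt_eq_iff)
  ultimately show ?thesis by (simp add: tau_torus_pt torus_pt_tau_params_eq_pt)
qed

end

section \<open>Both point schemes\<close>

theorem theorem4p3p1:
  fixes \<zeta> :: "'a::{alg_closed_field, field_char_0}"
  assumes "primitive_root_of_unity 8 \<zeta>"
  shows
    "(let P = closed_points (point_scheme (rels_S :: 'a presentation));
          \<tau> = tau (rels_S :: 'a presentation);
          ps = {p_pt \<zeta> j k | j k. j \<in> {0..3} \<and> k \<in> {0..3}};
          rest = ps - {pt 1 1 1 1, pt 1 1 (-1) (-1), pt 1 (-1) 1 (-1), pt 1 (-1) (-1) 1}
      in reduced_scheme (point_scheme (rels_S :: 'a presentation)) \<and>
         P = {e_pt 1, e_pt 2, e_pt 3, e_pt 4} \<union> ps \<and> card P = 20 \<and>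
         tau_automorphism (rels_S :: 'a presentation) \<and>
         \<tau> (e_pt 1) = e_pt 1 \<and> \<tau> (e_pt 2) = e_pt 2 \<and>
         \<tau> (e_pt 3) = e_pt 4 \<and> \<tau> (e_pt 4) = e_pt 3 \<and>
         (\<forall>j\<in>{0..3}. \<forall>k\<in>{0..3}.
            \<tau> (p_pt \<zeta> j k) = p_pt \<zeta> ((2 * k - j) mod 4) ((k - j) mod 4)) \<and>
         (\<forall>b c. b \<noteq> 0 \<longrightarrow> c \<noteq> 0 \<longrightarrow> pt 1 b c (inverse b * inverse c) \<in> ps \<longrightarrow>
            \<tau> (pt 1 b c (inverse b * inverse c)) = pt 1 (b^3 * c^2) (b^3 * c) (b^2 * c)) \<and>
         \<tau> (pt 1 1 1 1) = pt 1 1 1 1 \<and>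
         \<tau> (pt 1 1 (-1) (-1)) = pt 1 1 (-1) (-1) \<and>
         \<tau> (pt 1 (-1) 1 (-1)) = pt 1 (-1) (-1) 1 \<and>
         \<tau> (pt 1 (-1) (-1) 1) = pt 1 (-1) 1 (-1) \<and>
         card rest = 12 \<and> partitions_into_orbits \<tau> rest 3 4) \<and>
     (let P = closed_points (point_scheme (rels_T :: 'a presentation));
          \<tau> = tau (rels_T :: 'a presentation);
          qs = {q_pt \<zeta> j k | j k. j \<in> {0..3} \<and> k \<in> {0..3}}
      in reduced_scheme (point_scheme (rels_T :: 'a presentation)) \<and>
         P = {e_pt 1, e_pt 2, e_pt 3, e_pt 4} \<union> qs \<and> card P = 20 \<and>
         tau_automorphism (rels_T :: 'a presentation) \<and>
         \<tau> (e_pt 1) = e_pt 1 \<and> \<tau> (e_pt 2) = e_pt 2 \<and>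
         \<tau> (e_pt 3) = e_pt 4 \<and> \<tau> (e_pt 4) = e_pt 3 \<and>
         (\<forall>j\<in>{0..3}. \<forall>k\<in>{0..3}.
            \<tau> (q_pt \<zeta> j k) = q_pt \<zeta> ((2 * k + 1 - j) mod 4) ((k - j) mod 4)) \<and>
         (\<forall>b c. b \<noteq> 0 \<longrightarrow> c \<noteq> 0 \<longrightarrow> pt 1 b c (- (inverse b * inverse c)) \<in> qs \<longrightarrow>
            \<tau> (pt 1 b c (- (inverse b * inverse c))) = pt 1 (b^3 * c^2) (b^3 * c) (b^2 * c)) \<and>
         partitions_into_orbits \<tau> qs 4 4)"
proof -
  have "(\<zeta>^4)^2 = 1" "\<zeta>^4 \<noteq> 1"
    using assms by (simp_all add: primitive_root_of_unity_def flip: power_mult)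
  then have \<zeta>4: "\<zeta>^4 = - 1" unfolding power2_eq_1_iff by blast
  then have \<iota>2: "(\<zeta>^2)^2 = - 1" using \<zeta>4 by (simp flip: power_mult)
  interpret S: rels_family 1 1 "\<zeta>^2" by unfold_locales (simp_all add: \<iota>2 \<zeta>4)
  interpret T: rels_family "- 1" \<zeta> "\<zeta>^2" by unfold_locales (simp_all add: \<iota>2 \<zeta>4)
  have p_pt: "p_pt \<zeta> j k = S.torus_pt ((\<zeta>^2) powi j) ((\<zeta>^2) powi k)" for j k
    using S.torus_pt_powi by (simp add: p_pt_def)
  have q_pt: "q_pt \<zeta> j k = T.torus_pt ((\<zeta>^2) powi j) (\<zeta> * (\<zeta>^2) powi k)" for j k
    using T.torus_pt_powi by (simp add: q_pt_def)
  have S_Q: "{p_pt \<zeta> j k | j k. j \<in> {0..3} \<and> k \<in> {0..3}} = S.torus_points"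
    using S.torus_points_eq by (simp add: p_pt)
  have T_Q: "{q_pt \<zeta> j k | j k. j \<in> {0..3} \<and> k \<in> {0..3}} = T.torus_points"
    using T.torus_points_eq by (simp add: q_pt)
  have special: "pt 1 1 1 1 = S.torus_pt 1 1" "pt 1 1 (-1) (-1) = S.torus_pt 1 (-1)"
    "pt 1 (-1) 1 (-1) = S.torus_pt (-1) 1" "pt 1 (-1) (-1) 1 = S.torus_pt (-1) (-1)"
    by (simp_all add: S.torus_pt_def)
  have sq: "x^2 = 1 \<longleftrightarrow> x = 1 \<or> x = - 1" for x :: 'a by (rule power2_eq_1_iff)
  have one: "(1 :: 'a) \<noteq> - 1" by simp
  \<comment> \<open>The four sign pairs removed here are the parameters of the four exceptional
    points.\<close>
  have S_H: "S.moved_params = S.params - {1, - 1} \<times> {1, - 1}"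
    by (auto simp: S.moved_params_def S.params_def sq)
  have "{1, - 1} \<times> {1, - 1} \<subseteq> S.params" by (auto simp: S.params_def)
  then have "card S.moved_params = 12"
    unfolding S_H using one by (simp add: card_Diff_subset S.card_params card_cartesian_product)
  have rest: "S.torus_points - {pt 1 1 1 1, pt 1 1 (-1) (-1), pt 1 (-1) 1 (-1), pt 1 (-1) (-1) 1}
      = case_prod S.torus_pt ` S.moved_params"
    unfolding special S_H by (auto simp: S.torus_points_def S.torus_pt_eq_iff)
  have "card (case_prod S.torus_pt ` S.moved_params) = 12"
    by (simp add: card_image inj_on_subset[OF S.inj_torus_pt] \<open>card S.moved_params = 12\<close>)
  \<comment> \<open>In the second algebra \<open>c^4 = -1\<close> rules out \<open>c^2 = 1\<close>,
    so inversion fixes no parameter.\<close>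
  have "T.moved_params = T.params"
  proof -
    have "(c::'a)^4 = 1" if "c^2 = 1" for c
      using power_mult[of c 2 2] that by simp
    then show ?thesis by (auto simp: T.moved_params_def T.params_def)
  qed
  have S_tau: "tau (rels 1) (p_pt \<zeta> j k) = p_pt \<zeta> ((2 * k - j) mod 4) ((k - j) mod 4)" for j k
    using S.tau_torus_pt_powi[of j k] by (simp add: p_pt S.\<iota>_powi_mod)
  have T_tau: "tau (rels (- 1)) (q_pt \<zeta> j k) = q_pt \<zeta> ((2 * k + 1 - j) mod 4) ((k - j) mod 4)" for j k
  proof -
    \<comment> \<open>The extra factor is the \<open>\<gamma>^2\<close> of the general formula,
      absorbed into the exponent.\<close>
    have "(\<zeta>^2) powi (2 * k + 1 - j) = \<zeta>^2 * (\<zeta>^2) powi (2 * k - j)"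
      using power_int_add_1'[OF disjI1[OF T.\<iota>_power(1)], of "2 * k - j"] by (simp add: algebra_simps)
    then show ?thesis using T.tau_torus_pt_powi[of j k] by (simp add: q_pt T.\<iota>_powi_mod)
  qed
  show ?thesis
    unfolding Let_def rels_S_eq rels_T_eq S_Q T_Q rest S.closed_points_rels T.closed_points_rels
  proof (intro conjI ballI allI impI)
    show "partitions_into_orbits (tau (rels 1)) (case_prod S.torus_pt ` S.moved_params) 3 4"
      by (rule S.partitions_moved_params_into_orbits) (simp add: \<open>card S.moved_params = 12\<close>)
    show "partitions_into_orbits (tau (rels (- 1))) T.torus_points 4 4"
      using T.partitions_moved_params_into_orbits[of 4]
      by (simp add: \<open>T.moved_params = T.params\<close> T.card_params T.torus_points_def)
    show "tau (rels 1) (pt 1 b c (inverse b * inverse c)) = pt 1 (b^3 * c^2) (b^3 * c) (b^2 * c)"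
      if "pt 1 b c (inverse b * inverse c) \<in> S.torus_points" for b c
      using S.tau_explicit[of b c] that by simp
    show "tau (rels (- 1)) (pt 1 b c (- (inverse b * inverse c)))
        = pt 1 (b^3 * c^2) (b^3 * c) (b^2 * c)"
      if "pt 1 b c (- (inverse b * inverse c)) \<in> T.torus_points" for b c
      using T.tau_explicit[of b c] that by simp
    show "tau (rels (1 :: 'a)) (pt 1 1 1 1) = pt 1 1 1 1"
      "tau (rels (1 :: 'a)) (pt 1 1 (-1) (-1)) = pt 1 1 (-1) (-1)"
      "tau (rels (1 :: 'a)) (pt 1 (-1) 1 (-1)) = pt 1 (-1) (-1) 1"
      "tau (rels (1 :: 'a)) (pt 1 (-1) (-1) 1) = pt 1 (-1) 1 (-1)"
      by (simp_all add: special S.tau_torus_pt)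
  qed (simp_all only: S.vertices_def[symmetric] T.vertices_def[symmetric]
      S.card_vertices_Un_torus_points T.card_vertices_Un_torus_points
      S.reduced_scheme_rels T.reduced_scheme_rels S.tau_automorphism_rels T.tau_automorphism_rels
      S.tau_e_pt T.tau_e_pt S_tau T_tau \<open>card (case_prod S.torus_pt ` S.moved_params) = 12\<close>)
qed

end
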